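(* Assume Condition D and that $(H_1,H_2)$ is pure-state controllable. Then for every density matrix $\rho(0)$ on $\mathbb C^N$, with $\rho(t)=X(t)\rho(0)X(t)^*$, almost surely $\rho(t)\xrightarrow{c}\frac1NE$ as $t\to\infty$.
   Context: $H_1,H_2$ Hermitian $N\times N$, $U_k^t=e^{-itH_k}$; $J_n(s_1,\dots,s_n)=U_{k_n}^{s_n}\cdots U_{k_2}^{s_2}U_1^{s_1}$ with $k_j=1$ for odd $j$, $k_j=2$ for even $j$. Pure-state controllable: there is $n$ such that for every unit vector $\psi$, $\{J_n(s)\psi:s_j\ge0\}$ equals the unit sphere of $\mathbb C^N$. Condition D: $\tau_1,\tau_2,\dots$ i.i.d. positive with $\mathbb E\tau_1<\infty$ and a density positive on $[0,\infty)$; $t_n=\tau_1+\dots+\tau_n$, $t_0=0$; $X(t)=J_n(\tau_1,\dots,\tau_{n-1},t-t_{n-1})$ for $t_{n-1}\le t<t_n$. A density matrix is a nonnegative Hermitian matrix of trace 1. $\rho(t)\xrightarrow{c}\rho$ means $\frac1T\int_0^T\mathrm{Tr}(\rho(t)A)dt\to\mathrm{Tr}(\rho A)$ for every Hermitian $A$. $E$ is the identity. *)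

theory Defs
  imports "HOL-Probability.Probability"
begin

definition hermitian :: "complex^'n^'n \<Rightarrow> bool" where
  "hermitian A \<longleftrightarrow> (\<forall>i j. A $ i $ j = cnj (A $ j $ i))"

definition cadj :: "complex^'n^'n \<Rightarrow> complex^'n^'n" where
  "cadj A = (\<chi> i j. cnj (A $ j $ i))"

definition cscale :: "complex \<Rightarrow> complex^'n^'n \<Rightarrow> complex^'n^'n" where
  "cscale c A = (\<chi> i j. c * A $ i $ j)"

definition mexp :: "complex^'n^'n \<Rightarrow> complex^'n^'n" where
  "mexp A = (\<Sum>k. cscale (1 / of_nat (fact k)) (((\<lambda>B. A ** B) ^^ k) (mat 1)))"

definition evol :: "complex^'n^'n \<Rightarrow> real \<Rightarrow> complex^'n^'n" where
  "evol H t = mexp (cscale (- \<i> * complex_of_real t) H)"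

text \<open>J_n(s_1,...,s_n) = U_{k_n}^{s_n} ... U_1^{s_1}, with k_j = 1 for odd j and 2 for even j;
  the times are s 1, ..., s n (s 0 is unused).\<close>
fun Jprod :: "complex^'n^'n \<Rightarrow> complex^'n^'n \<Rightarrow> nat \<Rightarrow> (nat \<Rightarrow> real) \<Rightarrow> complex^'n^'n" where
  "Jprod H1 H2 0 s = mat 1"
| "Jprod H1 H2 (Suc n) s =
     evol (if odd (Suc n) then H1 else H2) (s (Suc n)) ** Jprod H1 H2 n s"

definition pure_state_controllable :: "complex^'n^'n \<Rightarrow> complex^'n^'n \<Rightarrow> bool" where
  "pure_state_controllable H1 H2 \<longleftrightarrow>
     (\<exists>n. \<forall>\<psi>::complex^'n. norm \<psi> = 1 \<longrightarrow>
        {Jprod H1 H2 n s *v \<psi> | s. \<forall>j\<in>{1..n}. s j \<ge> 0} = {x. norm x = 1})"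

definition tsum :: "(nat \<Rightarrow> 'w \<Rightarrow> real) \<Rightarrow> nat \<Rightarrow> 'w \<Rightarrow> real" where
  "tsum \<tau> n \<omega> = (\<Sum>i=1..n. \<tau> i \<omega>)"

definition Xproc :: "complex^'n^'n \<Rightarrow> complex^'n^'n \<Rightarrow> (nat \<Rightarrow> 'w \<Rightarrow> real) \<Rightarrow> real \<Rightarrow> 'w \<Rightarrow> complex^'n^'n" where
  "Xproc H1 H2 \<tau> t \<omega> =
     (let n = (LEAST n. t < tsum \<tau> n \<omega>)
      in Jprod H1 H2 n (\<lambda>j. if j < n then \<tau> j \<omega> else t - tsum \<tau> (n - 1) \<omega>))"

definition density_matrix :: "complex^'n^'n \<Rightarrow> bool" where
  "density_matrix \<rho> \<longleftrightarrow> hermitian \<rho> \<and>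
     (\<forall>x::complex^'n. 0 \<le> Re (\<Sum>i\<in>UNIV. cnj (x $ i) * (\<rho> *v x) $ i)) \<and> trace \<rho> = 1"

definition condition_D :: "'w measure \<Rightarrow> (nat \<Rightarrow> 'w \<Rightarrow> real) \<Rightarrow> bool" where
  "condition_D M \<tau> \<longleftrightarrow> prob_space M \<and>
     (\<forall>i\<ge>1. \<tau> i \<in> borel_measurable M) \<and>
     prob_space.indep_vars M (\<lambda>_. borel) \<tau> {1..} \<and>
     (\<forall>i\<ge>1. distr M borel (\<tau> i) = distr M borel (\<tau> 1)) \<and>
     (\<forall>i\<ge>1. AE \<omega> in M. \<tau> i \<omega> > 0) \<and>
     integrable M (\<tau> 1) \<and>
     (\<exists>f. distributed M lborel (\<tau> 1) f \<and> (\<forall>x\<ge>0. f x > 0))"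

definition cesaro_conv :: "(real \<Rightarrow> complex^'n^'n) \<Rightarrow> complex^'n^'n \<Rightarrow> bool" where
  "cesaro_conv \<rho>t \<rho> \<longleftrightarrow> (\<forall>A. hermitian A \<longrightarrow>
     ((\<lambda>T. complex_of_real (1 / T) * integral {0..T} (\<lambda>t. trace (\<rho>t t ** A)))
        \<longlongrightarrow> trace (\<rho> ** A)) at_top)"

end

(* Subtracting E/N, the state x is a traceless matrix evolving by norm-preserving conjugations.
   At the switching times, x_(n+1) minus the conditional mean P_k x_n is a bounded sequence of
   pairwise orthogonal random vectors, so its averages vanish almost surely; hence the averages
   e, o of x over even and odd n satisfy o - P_1 e -> 0 and e - P_2 o -> 0. If P_2 P_1 v = v, then,
   the P_k being means of isometries, strict convexity and the full support of tau force v to be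
   invariant under all conjugations, so by controllability its quadratic form is constant on the
   sphere, and a traceless v is 0. Thus 1 - P_2 P_1 is bounded below on traceless matrices and
   e, o -> 0. The same orthogonality argument treats the time integrals over the intervals with
   tau truncated at K; the excess (tau - K)^+ is only integrable, but a crude strong law bounds its
   averages by 2 E (tau - K)^+, which is small for large K. *)
theory Submission
  imports Defs
begin

section \<open>Laws of large numbers\<close>


text \<open>The observables are linear in the state, so the chain of states enters only through its
  conditional means, which are two linear contractions of a finite-dimensional Euclidean space.
  Centring at the expected limit makes that limit 0, and this eases the passage from the number of
  switches to time: a sum that is o(n) is also o(T) once the switching times grow at least linearly,
  so a lower bound for them is enough. Orthogonality works with bounded increments, while \<tau> has
  only a first moment; therefore the cut-off level stays fixed while n tends to infinity and grows
  only afterwards. All limits are proved for the vector-valued averages, so that one null set serves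
  every observable.\<close>

lemma (in prob_space) AE_tendsto_0_of_summable:
  fixes Y :: "nat \<Rightarrow> 'a \<Rightarrow> real"
  assumes int: "\<And>m. integrable M (Y m)" and nn: "\<And>m \<omega>. 0 \<le> Y m \<omega>"
    and bd: "\<And>m. expectation (Y m) \<le> a m" and sm: "summable a"
  shows "AE \<omega> in M. (\<lambda>m. Y m \<omega>) \<longlonglongrightarrow> 0"
proof -
  have [measurable]: "Y m \<in> borel_measurable M" for m
    using int by auto
  have a0: "0 \<le> a m" for m
    using order_trans[OF Bochner_Integration.integral_nonneg bd[of m]] nn by blast
  \<comment> \<open>The whole series has finite expectation, hence converges almost surely, which
    forces its terms to 0.\<close>
  have "(\<integral>\<^sup>+ \<omega>. (\<Sum>m. ennreal (Y m \<omega>)) \<partial>M) = (\<Sum>m. \<integral>\<^sup>+ \<omega>. ennreal (Y m \<omega>) \<partial>M)"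
    by (intro nn_integral_suminf) auto
  also have "\<dots> = (\<Sum>m. ennreal (expectation (Y m)))"
    using int nn by (simp add: nn_integral_eq_integral)
  also have "\<dots> \<le> (\<Sum>m. ennreal (a m))"
    by (intro suminf_le) (auto intro: ennreal_leI bd)
  also have "\<dots> = ennreal (\<Sum>m. a m)"
    by (rule suminf_ennreal2) (use a0 sm in auto)
  finally have "(\<integral>\<^sup>+ \<omega>. (\<Sum>m. ennreal (Y m \<omega>)) \<partial>M) \<noteq> \<infinity>"
    by (auto simp: top_unique)
  then have "AE \<omega> in M. (\<Sum>m. ennreal (Y m \<omega>)) \<noteq> \<infinity>"
    by (intro nn_integral_PInf_AE) auto
  then show ?thesis
  proof eventually_elim
    case (elim \<omega>)
    then have "summable (\<lambda>m. Y m \<omega>)"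
      by (intro summable_suminf_not_top) (use nn in auto)
    then show ?case by (rule summable_LIMSEQ_zero)
  qed
qed

text \<open>Pythagoras in L^2. The uniform bound makes all cross terms integrable, so that the
  square may be expanded under the expectation.\<close>

lemma (in prob_space) expectation_norm_sum_orthogonal:
  fixes D :: "nat \<Rightarrow> 'a \<Rightarrow> 'v::euclidean_space"
  assumes [measurable]: "\<And>i. D i \<in> borel_measurable M" and bd: "\<And>i \<omega>. norm (D i \<omega>) \<le> C"
    and orth: "\<And>i j. i < j \<Longrightarrow> expectation (\<lambda>\<omega>. D i \<omega> \<bullet> D j \<omega>) = 0"
  shows "integrable M (\<lambda>\<omega>. (norm (\<Sum>i<n. D i \<omega>))\<^sup>2)"
    and "expectation (\<lambda>\<omega>. (norm (\<Sum>i<n. D i \<omega>))\<^sup>2) = (\<Sum>i<n. expectation (\<lambda>\<omega>. (norm (D i \<omega>))\<^sup>2))"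
proof -
  have C0: "0 \<le> C" using bd[of 0 undefined] norm_ge_zero order_trans by blast
  have int: "integrable M (\<lambda>\<omega>. D i \<omega> \<bullet> D j \<omega>)" for i j
  proof (rule integrable_const_bound[where B="C * C"])
    have "\<bar>D i \<omega> \<bullet> D j \<omega>\<bar> \<le> C * C" for \<omega>
      by (rule order_trans[OF Cauchy_Schwarz_ineq2]) (intro mult_mono bd C0 norm_ge_zero)
    then show "AE \<omega> in M. norm (D i \<omega> \<bullet> D j \<omega>) \<le> C * C" by simp
  qed measurable
  have eq: "(norm (\<Sum>i<n. D i \<omega>))\<^sup>2 = (\<Sum>i<n. \<Sum>j<n. D i \<omega> \<bullet> D j \<omega>)" for \<omega>
    by (simp only: power2_norm_eq_inner inner_sum_left) (simp only: inner_sum_right)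
  show "integrable M (\<lambda>\<omega>. (norm (\<Sum>i<n. D i \<omega>))\<^sup>2)"
    unfolding eq by (intro Bochner_Integration.integrable_sum int)
  have orth': "expectation (\<lambda>\<omega>. D i \<omega> \<bullet> D j \<omega>) = 0" if "i \<noteq> j" for i j
    using that orth[of i j] orth[of j i] by (cases "i < j") (auto simp: inner_commute)
  have "expectation (\<lambda>\<omega>. (norm (\<Sum>i<n. D i \<omega>))\<^sup>2)
      = (\<Sum>i<n. \<Sum>j<n. expectation (\<lambda>\<omega>. D i \<omega> \<bullet> D j \<omega>))"
    unfolding eq by (simp add: int)
  also have "\<dots> = (\<Sum>i<n. \<Sum>j<n. if i = j then expectation (\<lambda>\<omega>. (norm (D i \<omega>))\<^sup>2) else 0)"
    by (intro sum.cong refl) (auto simp: orth' power2_norm_eq_inner)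
  also have "\<dots> = (\<Sum>i<n. expectation (\<lambda>\<omega>. (norm (D i \<omega>))\<^sup>2))"
    by simp
  finally show "expectation (\<lambda>\<omega>. (norm (\<Sum>i<n. D i \<omega>))\<^sup>2)
      = (\<Sum>i<n. expectation (\<lambda>\<omega>. (norm (D i \<omega>))\<^sup>2))" .
qed

text \<open>By orthogonality the mean square of the average of \<open>n\<close> terms is at most
  C^2/n, which is summable along the squares n = m^2. Between consecutive squares the partial sum
  moves by at most \<open>C\<close> times a gap of order sqrt n, which is o(n).\<close>

lemma (in prob_space) bounded_orthogonal_strong_law:
  fixes D :: "nat \<Rightarrow> 'a \<Rightarrow> 'v::euclidean_space"
  assumes [measurable]: "\<And>i. D i \<in> borel_measurable M" and bd: "\<And>i \<omega>. norm (D i \<omega>) \<le> C"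
    and orth: "\<And>i j. i < j \<Longrightarrow> expectation (\<lambda>\<omega>. D i \<omega> \<bullet> D j \<omega>) = 0"
  shows "AE \<omega> in M. (\<lambda>n. (\<Sum>i<n. D i \<omega>) /\<^sub>R real n) \<longlonglongrightarrow> 0"
proof -
  have C0: "0 \<le> C" using bd[of 0 undefined] norm_ge_zero order_trans by blast
  define S where "S = (\<lambda>n \<omega>. \<Sum>i<n. D i \<omega>)"
  define Y where "Y = (\<lambda>m \<omega>. (norm (S ((Suc m)\<^sup>2) \<omega>) / real ((Suc m)\<^sup>2))\<^sup>2)"
  note E = expectation_norm_sum_orthogonal[OF assms(1) bd orth, simplified]
  have Yeq: "Y m \<omega> = (1 / real ((Suc m)\<^sup>2))\<^sup>2 * (norm (\<Sum>i<(Suc m)\<^sup>2. D i \<omega>))\<^sup>2" for m \<omega>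
    unfolding Y_def S_def by (simp only: power_divide power_one divide_inverse mult_1_left mult.commute power_mult_distrib)
  have D2: "expectation (\<lambda>\<omega>. (norm (D i \<omega>))\<^sup>2) \<le> C\<^sup>2" for i
  proof -
    have "expectation (\<lambda>\<omega>. (norm (D i \<omega>))\<^sup>2) \<le> expectation (\<lambda>\<omega>. C\<^sup>2)"
      by (intro integral_mono integrable_const_bound[where B="C\<^sup>2"] AE_I2)
        (auto intro!: power_mono bd C0)
    then show ?thesis by (simp add: prob_space)
  qed
  have EY: "expectation (Y m) \<le> C\<^sup>2 / real ((Suc m)\<^sup>2)" for m
  proof -
    have "expectation (Y m) = (1 / real ((Suc m)\<^sup>2))\<^sup>2 * (\<Sum>i<(Suc m)\<^sup>2. expectation (\<lambda>\<omega>. (norm (D i \<omega>))\<^sup>2))"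
      unfolding Yeq using E by simp
    also have "\<dots> \<le> (1 / real ((Suc m)\<^sup>2))\<^sup>2 * (\<Sum>i<(Suc m)\<^sup>2. C\<^sup>2)"
      by (intro mult_left_mono sum_mono D2) auto
    also have "\<dots> = C\<^sup>2 / real ((Suc m)\<^sup>2)"
      by (simp add: power2_eq_square divide_simps)
    finally show ?thesis .
  qed
  have sm: "summable (\<lambda>m. C\<^sup>2 / real ((Suc m)\<^sup>2))"
  proof -
    have "summable (\<lambda>m. C\<^sup>2 * inverse (real (Suc m) ^ 2))"
      by (intro summable_mult) (use inverse_power_summable[of 2, where 'a=real] in \<open>subst summable_Suc_iff\<close>, simp)
    then show ?thesis by (simp add: field_simps)
  qed
  have "integrable M (Y m)" for m
    unfolding Yeq[abs_def] using E by simp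
  then have "AE \<omega> in M. (\<lambda>m. Y m \<omega>) \<longlonglongrightarrow> 0"
    by (rule AE_tendsto_0_of_summable[OF _ _ EY sm]) (simp add: Yeq)
  then show ?thesis
  proof eventually_elim
    case (elim \<omega>)
    define r where "r = (\<lambda>n. floor_sqrt n)"
    have "(\<lambda>m. sqrt (Y m \<omega>)) \<longlonglongrightarrow> 0"
      using tendsto_real_sqrt[OF elim] by simp
    then have "(\<lambda>m. norm (S ((Suc m)\<^sup>2) \<omega>) / real ((Suc m)\<^sup>2)) \<longlonglongrightarrow> 0"
      unfolding Y_def by (simp only: real_sqrt_abs abs_divide abs_norm_cancel abs_of_nat)
    then have lim1: "(\<lambda>m. norm (S (m\<^sup>2) \<omega>) / real (m\<^sup>2)) \<longlonglongrightarrow> 0"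
      by (rule filterlim_sequentially_Suc[THEN iffD1])
    have rlim: "filterlim r at_top sequentially"
      unfolding r_def filterlim_at_top
    proof
      show "\<forall>\<^sub>F n in sequentially. Z \<le> floor_sqrt n" for Z
        by (rule eventually_sequentiallyI[of "Z\<^sup>2"]) (simp add: le_floor_sqrt_iff)
    qed
    have l1: "(\<lambda>n. norm (S ((r n)\<^sup>2) \<omega>) / real ((r n)\<^sup>2) + C * (3 / real (r n))) \<longlonglongrightarrow> 0"
      using tendsto_add[OF filterlim_compose[OF lim1 rlim]
          tendsto_mult_right_zero[OF filterlim_compose[OF lim_const_over_n[of 3] rlim], of C]] by simp
    have "norm (S n \<omega> /\<^sub>R real n) \<le> norm (S ((r n)\<^sup>2) \<omega>) / real ((r n)\<^sup>2) + C * (3 / real (r n))" if "n > 0" for n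
    proof -
      have r1: "(r n)\<^sup>2 \<le> n" and r2: "n < (Suc (r n))\<^sup>2" and r0: "r n > 0"
        using that by (auto simp: r_def Suc_floor_sqrt_power2_gt)
      have "S n \<omega> = S ((r n)\<^sup>2) \<omega> + (\<Sum>i\<in>{(r n)\<^sup>2..<n}. D i \<omega>)"
        unfolding S_def lessThan_atLeast0 using r1 by (intro sum.atLeastLessThan_concat[symmetric]) auto
      then have "norm (S n \<omega>) \<le> norm (S ((r n)\<^sup>2) \<omega>) + norm (\<Sum>i\<in>{(r n)\<^sup>2..<n}. D i \<omega>)"
        using norm_triangle_ineq by metis
      also have "norm (\<Sum>i\<in>{(r n)\<^sup>2..<n}. D i \<omega>) \<le> real (card {(r n)\<^sup>2..<n}) * C"
        using sum_norm_bound[of "{(r n)\<^sup>2..<n}" "\<lambda>i. D i \<omega>" C] bd by simp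
      also have "\<dots> \<le> (3 * real (r n)) * C"
      proof -
        \<comment> \<open>The gap is at most 2r, since n < (r + 1)^2; the factor 3 leaves
          room.\<close>
        have "n - (r n)\<^sup>2 \<le> 3 * r n"
          using r2 r0 by (simp add: power2_eq_square)
        then have "real (n - (r n)\<^sup>2) \<le> real (3 * r n)" by (simp only: of_nat_le_iff)
        then show ?thesis using C0 by (intro mult_right_mono) auto
      qed
      finally have a: "norm (S n \<omega>) \<le> norm (S ((r n)\<^sup>2) \<omega>) + 3 * real (r n) * C" by simp
      have "norm (S n \<omega> /\<^sub>R real n) = norm (S n \<omega>) / real n"
        using that by (simp add: divide_inverse mult.commute)
      also have "\<dots> \<le> (norm (S ((r n)\<^sup>2) \<omega>) + 3 * real (r n) * C) / real ((r n)\<^sup>2)"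
      proof (intro frac_le a)
        show "real ((r n)\<^sup>2) \<le> real n" using r1 by (simp only: of_nat_le_iff)
      qed (use r0 C0 in auto)
      also have "\<dots> = norm (S ((r n)\<^sup>2) \<omega>) / real ((r n)\<^sup>2) + C * (3 / real (r n))"
        using r0 by (simp add: field_simps power2_eq_square)
      finally show ?thesis .
    qed
    then have "(\<lambda>n. S n \<omega> /\<^sub>R real n) \<longlonglongrightarrow> 0"
      by (intro Lim_null_comparison[OF _ l1] eventually_sequentiallyI[of 1]) (simp add: S_def)
    then show ?case by (simp add: S_def)
  qed
qed


text \<open>The terms with 2^k < z equal 2^k, the later ones z^2/2^k. Both parts are geometric and
  dominated by their terms next to z, so each contributes at most 2z.\<close>

lemma sum_min_power2_le:
  fixes z :: real
  assumes "0 \<le> z"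
  shows "(\<Sum>k<n. (min z (2 ^ k))\<^sup>2 / 2 ^ k) \<le> 4 * z"
proof -
  let ?S = "\<lambda>n. \<Sum>k<n. (min z (2 ^ k))\<^sup>2 / 2 ^ k"
  \<comment> \<open>Strengthened for the induction: once 2^n has passed z, the whole future
    contribution 2 z^2/2^n is already held in reserve; before that, the sum is 2^n - 1.\<close>
  have "?S n \<le> (if z \<le> 2 ^ n then 4 * z - 2 * (z\<^sup>2 / 2 ^ n) else 2 ^ n)" for n
  proof (induction n)
    case 0
    have "2 * z\<^sup>2 \<le> 4 * z" if "z \<le> 1"
      using mult_left_mono[OF that assms] assms by (simp add: power2_eq_square)
    then show ?case by simp
  next
    case (Suc n)
    consider "z \<le> 2 ^ n" | "2 ^ n < z" "z \<le> 2 ^ Suc n" | "2 ^ Suc n < z" by linarith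
    then show ?case
    proof cases
      case 1
      then have z: "z \<le> 2 ^ Suc n" using assms by simp
      define u where "u = z\<^sup>2 / 2 ^ n"
      have "z\<^sup>2 / 2 ^ Suc n = u / 2" by (simp add: u_def)
      then show ?thesis
        using 1 z Suc by (simp only: sum.lessThan_Suc min_absorb1 if_True u_def[symmetric])
    next
      case 2
      define a :: real where "a = 2 ^ n"
      have a: "a > 0" "a < z" "z \<le> 2 * a" using 2 by (auto simp: a_def)
      have "0 \<le> (z - a) * (2 * a - z) + (z - a) * a + a * a"
        using a by (intro add_nonneg_nonneg mult_nonneg_nonneg) auto
      then have "2 * a * a \<le> 4 * z * a - z * z" by (simp add: algebra_simps)
      then have "2 * a \<le> 4 * z - z\<^sup>2 / a" using a by (simp add: field_simps power2_eq_square)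
      moreover have "?S (Suc n) \<le> 2 * a" using 2 Suc by (simp add: a_def power2_eq_square)
      ultimately show ?thesis using 2 by (simp add: a_def)
    next
      case 3
      moreover have "(2::real) ^ n \<le> 2 ^ Suc n" by simp
      ultimately have "2 ^ n < z" by linarith
      then show ?thesis using 3 Suc by (simp add: power2_eq_square)
    qed
  qed
  also have "(if z \<le> 2 ^ n then 4 * z - 2 * (z\<^sup>2 / 2 ^ n) else 2 ^ n) \<le> 4 * z"
    using assms by auto
  finally show ?thesis .
qed

lemma (in prob_space) expectation_identically_distributed:
  fixes g :: "real \<Rightarrow> 'v::{banach,second_countable_topology}"
  assumes [measurable]: "X \<in> borel_measurable M" "Y \<in> borel_measurable M" "g \<in> borel_measurable borel"
    and id: "distr M borel X = distr M borel Y"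
  shows "expectation (\<lambda>\<omega>. g (X \<omega>)) = expectation (\<lambda>\<omega>. g (Y \<omega>))"
proof -
  have "expectation (\<lambda>\<omega>. g (X \<omega>)) = integral\<^sup>L (distr M borel X) g"
    by (rule integral_distr[symmetric]) measurable
  also have "\<dots> = expectation (\<lambda>\<omega>. g (Y \<omega>))"
    unfolding id by (rule integral_distr) measurable
  finally show ?thesis .
qed

text \<open>The source of all orthogonality below, used with a centred \<open>g\<close>. The past is
  a function on the product over \<open>{..<j}\<close>, because independence of disjoint blocks of
  variables is expressed through such restrictions.\<close>

lemma (in prob_space) indep_vars_expectation_past:
  fixes A :: "(nat \<Rightarrow> real) \<Rightarrow> real" and g :: "real \<Rightarrow> real"
  assumes ind: "indep_vars (\<lambda>_. borel) X UNIV"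
    and [measurable]: "A \<in> borel_measurable (PiM {..<j} (\<lambda>_. borel))" "g \<in> borel_measurable borel"
    and "integrable M (\<lambda>\<omega>. A (restrict (\<lambda>i. X i \<omega>) {..<j}))" "integrable M (\<lambda>\<omega>. g (X j \<omega>))"
  shows "expectation (\<lambda>\<omega>. A (restrict (\<lambda>i. X i \<omega>) {..<j}) * g (X j \<omega>)) =
    expectation (\<lambda>\<omega>. A (restrict (\<lambda>i. X i \<omega>) {..<j})) * expectation (\<lambda>\<omega>. g (X j \<omega>))"
proof -
  have "indep_var (PiM {..<j} (\<lambda>_. borel)) (\<lambda>\<omega>. restrict (\<lambda>i. X i \<omega>) {..<j})
      (PiM {j} (\<lambda>_. borel)) (\<lambda>\<omega>. restrict (\<lambda>i. X i \<omega>) {j})"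
    by (rule indep_var_restrict[OF ind]) auto
  then have "indep_var borel (A \<circ> (\<lambda>\<omega>. restrict (\<lambda>i. X i \<omega>) {..<j}))
      borel ((\<lambda>s. g (s j)) \<circ> (\<lambda>\<omega>. restrict (\<lambda>i. X i \<omega>) {j}))"
    by (rule indep_var_compose) measurable
  from indep_var_lebesgue_integral[OF this] show ?thesis
    using assms by (simp add: o_def)
qed

text \<open>The constant \<open>2\<close> is the price of comparing with dyadic times only; the truncation at the
  dyadic level \<open>2 ^ k\<close> both controls the variance and, by Borel-Cantelli, is eventually inactive.\<close>

lemma (in prob_space) iid_average_eventually_le:
  fixes Z :: "nat \<Rightarrow> 'a \<Rightarrow> real"
  assumes ind: "indep_vars (\<lambda>_. borel) Z UNIV"
    and id: "\<And>i. distr M borel (Z i) = distr M borel (Z 0)"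
    and nn: "\<And>i \<omega>. 0 \<le> Z i \<omega>" and int: "integrable M (Z 0)" and "\<epsilon> > 0"
  shows "AE \<omega> in M. \<forall>\<^sub>F n in sequentially. (\<Sum>i<n. Z i \<omega>) \<le> real n * (2 * expectation (Z 0) + \<epsilon>)"
proof -
  have [measurable]: "Z i \<in> borel_measurable M" for i
    using ind by (auto simp: indep_vars_def)
  define T where "T = (\<lambda>(k::nat) x::real. min x (2 ^ k))"
  have [measurable]: "T k \<in> borel_measurable borel" for k unfolding T_def by measurable
  have T0: "0 \<le> T k (Z i \<omega>)" and T1: "T k (Z i \<omega>) \<le> 2 ^ k" for k i \<omega>
    using nn by (auto simp: T_def)
  have intT: "integrable M (\<lambda>\<omega>. T k (Z i \<omega>))" for k i
    by (rule integrable_const_bound[where B="2 ^ k"]) (use T0 T1 in auto)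
  have intT2: "integrable M (\<lambda>\<omega>. (T k (Z i \<omega>))\<^sup>2)" for k i
    by (rule integrable_const_bound[where B="(2 ^ k)\<^sup>2"]) (use T0 T1 in \<open>auto intro!: power_mono\<close>)
  define m where "m = (\<lambda>k. expectation (\<lambda>\<omega>. T k (Z 0 \<omega>)))"
  define q where "q = (\<lambda>k. expectation (\<lambda>\<omega>. (T k (Z 0 \<omega>))\<^sup>2))"
  have mi: "expectation (\<lambda>\<omega>. T k (Z i \<omega>)) = m k" for k i
    unfolding m_def by (rule expectation_identically_distributed[OF _ _ _ id]) measurable
  have qi: "expectation (\<lambda>\<omega>. (T k (Z i \<omega>))\<^sup>2) = q k" for k i
    unfolding q_def by (rule expectation_identically_distributed[OF _ _ _ id, where g="\<lambda>x. (T k x)\<^sup>2"]) measurable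
  have q0: "0 \<le> q k" for k unfolding q_def by (rule Bochner_Integration.integral_nonneg) auto
  \<comment> \<open>The dyadic sum bound turns the first moment of \<open>Z 0\<close> into
    summability of the truncated second moments. This one series controls both the fluctuations and
    the truncation.\<close>
  have sm: "summable (\<lambda>k. q k / 2 ^ k)"
  proof (rule summableI_nonneg_bounded)
    fix n
    have "(\<Sum>k<n. q k / 2 ^ k) = expectation (\<lambda>\<omega>. \<Sum>k<n. (T k (Z 0 \<omega>))\<^sup>2 / 2 ^ k)"
      unfolding q_def using intT2 by simp
    also have "\<dots> \<le> expectation (\<lambda>\<omega>. 4 * Z 0 \<omega>)"
      unfolding T_def
      by (rule integral_mono)
        (use intT2 int nn in \<open>auto simp: T_def intro!: sum_min_power2_le\<close>)
    finally show "(\<Sum>k<n. q k / 2 ^ k) \<le> 4 * expectation (Z 0)" using int by simp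
  qed (simp add: q0)
  define D where "D = (\<lambda>k i \<omega>. T k (Z i \<omega>) - m k)"
  have [measurable]: "D k i \<in> borel_measurable M" for k i unfolding D_def by measurable
  have Dbd: "norm (D k i \<omega>) \<le> 2 ^ k + \<bar>m k\<bar>" for k i \<omega>
    using T0[of k i \<omega>] T1[of k i \<omega>] by (simp add: D_def abs_if)
  have Dorth: "expectation (\<lambda>\<omega>. D k i \<omega> \<bullet> D k j \<omega>) = 0" if "i < j" for k i j
  proof -
    have "expectation (\<lambda>\<omega>. D k i \<omega> * D k j \<omega>) = expectation (D k i) * expectation (D k j)"
      using indep_vars_expectation_past[OF ind, of "\<lambda>s. T k (s i) - m k" j "\<lambda>x. T k x - m k"]
        that intT by (simp add: D_def)
    also have "expectation (D k i) = 0" unfolding D_def using intT mi by (simp add: prob_space)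
    finally show ?thesis by simp
  qed
  note E = expectation_norm_sum_orthogonal[of "D k" for k, OF _ Dbd Dorth, simplified]
  define V where "V = (\<lambda>k \<omega>. ((\<Sum>i<2 ^ k. D k i \<omega>) / 2 ^ k)\<^sup>2)"
  have V1: "AE \<omega> in M. (\<lambda>k. V k \<omega>) \<longlonglongrightarrow> 0"
  proof (rule AE_tendsto_0_of_summable[OF _ _ _ sm])
    show "integrable M (V k)" for k
      unfolding V_def using E(1)[of k "2 ^ k"] by (simp add: power_divide)
    show "expectation (V k) \<le> q k / 2 ^ k" for k
    proof -
      have v: "expectation (\<lambda>\<omega>. (D k i \<omega>)\<^sup>2) \<le> q k" for i
        using variance_eq[OF intT intT2, of k i] unfolding mi qi D_def by simp
      have "expectation (V k) = (\<Sum>i<2 ^ k. expectation (\<lambda>\<omega>. (D k i \<omega>)\<^sup>2)) / (2 ^ k)\<^sup>2"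
        unfolding V_def using E(2)[of k "2 ^ k"] by (simp add: power_divide)
      also have "\<dots> \<le> (\<Sum>i<2 ^ k::nat. q k) / (2 ^ k)\<^sup>2"
        by (intro divide_right_mono sum_mono v) auto
      also have "\<dots> = q k / 2 ^ k" by (simp add: power2_eq_square)
      finally show ?thesis .
    qed
  qed (simp add: V_def)
  \<comment> \<open>\<open>Q k\<close> counts the indices below 2^k at which truncation at 2^k is
    active. Being a count, it is 0 as soon as it is less than 1.\<close>
  define Q where "Q = (\<lambda>k \<omega>. \<Sum>i<2 ^ k. indicator {2 ^ k<..} (Z i \<omega>) :: real)"
  have Q1: "AE \<omega> in M. (\<lambda>k. Q k \<omega>) \<longlonglongrightarrow> 0"
  proof (rule AE_tendsto_0_of_summable[OF _ _ _ sm])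
    have int1: "integrable M (\<lambda>\<omega>. indicator {2 ^ k<..} (Z i \<omega>) :: real)" for k i
      by (rule integrable_const_bound[where B=1]) (auto simp: indicator_def)
    then show "integrable M (Q k)" for k unfolding Q_def by simp
    show "expectation (Q k) \<le> q k / 2 ^ k" for k
    proof -
      \<comment> \<open>Chebyshev in pointwise form: where \<open>Z i\<close> exceeds 2^k its
        truncation equals 2^k and the right-hand side is 1.\<close>
      have "indicator {2 ^ k<..} (Z i \<omega>) \<le> (T k (Z i \<omega>))\<^sup>2 / (2 ^ k)\<^sup>2" for i \<omega>
        by (auto simp: T_def indicator_def)
      then have "expectation (\<lambda>\<omega>. indicator {2 ^ k<..} (Z i \<omega>)) \<le> expectation (\<lambda>\<omega>. (T k (Z i \<omega>))\<^sup>2 / (2 ^ k)\<^sup>2)" for i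
        using int1 intT2 by (intro integral_mono) auto
      also have "expectation (\<lambda>\<omega>. (T k (Z i \<omega>))\<^sup>2 / (2 ^ k)\<^sup>2) = q k / (2 ^ k)\<^sup>2" for i
        using qi by simp
      finally have v: "expectation (\<lambda>\<omega>. indicator {2 ^ k<..} (Z i \<omega>)) \<le> q k / (2 ^ k)\<^sup>2" for i .
      have "expectation (Q k) \<le> (\<Sum>i<2 ^ k::nat. q k / (2 ^ k)\<^sup>2)"
        unfolding Q_def using int1 by (simp only: Bochner_Integration.integral_sum) (intro sum_mono v)
      also have "\<dots> = q k / 2 ^ k" by (simp add: power2_eq_square)
      finally show ?thesis .
    qed
  qed (auto simp: Q_def intro!: sum_nonneg)
  have m_le: "m k \<le> expectation (Z 0)" for k
    unfolding m_def using intT int by (intro integral_mono) (auto simp: T_def)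
  show ?thesis using V1 Q1
  proof eventually_elim
    case (elim \<omega>)
    have "\<forall>\<^sub>F k in sequentially. V k \<omega> < (\<epsilon> / 2)\<^sup>2 \<and> Q k \<omega> < 1"
      by (intro eventually_conj order_tendstoD(2)[OF elim(1)] order_tendstoD(2)[OF elim(2)])
        (use \<open>\<epsilon> > 0\<close> in auto)
    then obtain k0 where k0: "\<And>k. k \<ge> k0 \<Longrightarrow> V k \<omega> < (\<epsilon> / 2)\<^sup>2 \<and> Q k \<omega> < 1"
      by (auto simp: eventually_sequentially)
    have dy: "(\<Sum>i<2 ^ k. Z i \<omega>) \<le> 2 ^ k * (expectation (Z 0) + \<epsilon> / 2)" if "k \<ge> k0" for k
    proof -
      have le: "Z i \<omega> \<le> 2 ^ k" if "i < 2 ^ k" for i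
      proof (rule ccontr)
        assume "\<not> Z i \<omega> \<le> 2 ^ k"
        then have "1 = (indicator {2 ^ k<..} (Z i \<omega>) :: real)" by simp
        also have "\<dots> \<le> Q k \<omega>" unfolding Q_def
          by (rule member_le_sum) (use that in auto)
        finally show False using k0[OF \<open>k \<ge> k0\<close>] by simp
      qed
      have "\<bar>(\<Sum>i<2 ^ k. D k i \<omega>) / 2 ^ k\<bar> < \<epsilon> / 2"
        proof (rule power2_less_imp_less)
        show "\<bar>(\<Sum>i<2 ^ k. D k i \<omega>) / 2 ^ k\<bar>\<^sup>2 < (\<epsilon> / 2)\<^sup>2"
          using conjunct1[OF k0[OF that]] unfolding V_def power2_abs .
      qed (use \<open>\<epsilon> > 0\<close> in simp)
      then have "(\<Sum>i<2 ^ k. D k i \<omega>) \<le> 2 ^ k * (\<epsilon> / 2)"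
        by (simp add: abs_less_iff field_simps)
      moreover have "(\<Sum>i<2 ^ k. D k i \<omega>) = (\<Sum>i<2 ^ k. Z i \<omega>) - 2 ^ k * m k"
        using le by (simp add: D_def T_def sum_subtractf min_absorb1)
      moreover have "2 ^ k * m k \<le> 2 ^ k * expectation (Z 0)" using m_le by simp
      ultimately show ?thesis unfolding distrib_left by linarith
    qed
    show ?case
    proof (rule eventually_sequentiallyI[of "2 ^ k0"])
      fix n :: nat assume n: "2 ^ k0 \<le> n"
      then have "1 \<le> n" using order_trans[OF one_le_power[of "2::nat" k0]] by simp
      then obtain k where k: "2 ^ k \<le> n" "n < 2 ^ (k + 1)"
        using ex_power_ivl1[of 2 n] by auto
      have "2 ^ k0 < (2::nat) ^ (k + 1)" using n k by linarith
      then have kk: "k0 \<le> k + 1" using power_less_imp_less_exp[of "2::nat" k0 "k + 1"] by simp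
      have "(\<Sum>i<n. Z i \<omega>) \<le> (\<Sum>i<2 ^ (k + 1). Z i \<omega>)"
        by (rule sum_mono2) (use k nn in auto)
      also have "\<dots> \<le> 2 ^ (k + 1) * (expectation (Z 0) + \<epsilon> / 2)" by (rule dy[OF kk])
      also have "\<dots> = 2 ^ k * (2 * expectation (Z 0) + \<epsilon>)" by (simp add: algebra_simps)
      also have "\<dots> \<le> real n * (2 * expectation (Z 0) + \<epsilon>)"
      proof (rule mult_right_mono)
        have "real (2 ^ k) \<le> real n" using k(1) by (simp only: of_nat_le_iff)
        then show "2 ^ k \<le> real n" by simp
        show "0 \<le> 2 * expectation (Z 0) + \<epsilon>"
          using \<open>\<epsilon> > 0\<close> nn by (intro add_nonneg_nonneg mult_nonneg_nonneg Bochner_Integration.integral_nonneg) auto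
      qed
      finally show "(\<Sum>i<n. Z i \<omega>) \<le> real n * (2 * expectation (Z 0) + \<epsilon>)" .
    qed
  qed
qed

section \<open>Randomly switched isometries\<close>


text \<open>Common form of the three functionals of a step that get averaged: the step map itself,
  the step map restricted to one parity, and the time integral over a truncated interval. The bound
  is uniform in \<open>t\<close>, as the strong law for bounded increments requires.\<close>

definition bounded_linear_family :: "('b \<Rightarrow> real \<Rightarrow> 'v::euclidean_space \<Rightarrow> 'v) \<Rightarrow> real \<Rightarrow> bool" where
  "bounded_linear_family F C \<longleftrightarrow> (\<forall>b t. linear (F b t)) \<and>
     (\<forall>b t v. norm (F b t v) \<le> C * norm v) \<and> (\<forall>b v. (\<lambda>t. F b t v) \<in> borel_measurable borel)"

lemma bounded_linear_familyD:
  assumes "bounded_linear_family F C"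
  shows "linear (F b t)" "norm (F b t v) \<le> C * norm v" "(\<lambda>t. F b t v) \<in> borel_measurable borel"
  using assms by (auto simp: bounded_linear_family_def)

lemma linear_expand_Basis:
  fixes f :: "'v::euclidean_space \<Rightarrow> 'u::real_vector"
  assumes "linear f"
  shows "f v = (\<Sum>e\<in>Basis. (v \<bullet> e) *\<^sub>R f e)"
proof -
  have "f v = f (\<Sum>e\<in>Basis. (v \<bullet> e) *\<^sub>R e)" by (simp add: euclidean_representation)
  also have "\<dots> = (\<Sum>e\<in>Basis. (v \<bullet> e) *\<^sub>R f e)" using assms by (simp add: linear_sum linear_cmul)
  finally show ?thesis .
qed

text \<open>Measurability in time for each fixed vector becomes joint measurability because
  linearity reduces the vector argument to finitely many coordinates.\<close>

lemma measurable_bounded_linear_family: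
  assumes F: "bounded_linear_family F C"
    and [measurable]: "f \<in> borel_measurable N" "g \<in> borel_measurable N"
  shows "(\<lambda>\<omega>. F b (f \<omega>) (g \<omega>)) \<in> borel_measurable N"
proof -
  have [measurable]: "(\<lambda>\<omega>. F b (f \<omega>) e) \<in> borel_measurable N" for e
    by (rule measurable_compose[OF assms(2) bounded_linear_familyD(3)[OF F]])
  show ?thesis
    by (subst linear_expand_Basis[OF bounded_linear_familyD(1)[OF F]]) measurable
qed

text \<open>Step \<open>n + 1\<close> applies \<open>R (even n)\<close>, so that \<open>R True\<close> is the first map and \<open>R False\<close> the second.\<close>

locale random_switching = prob_space M for M :: "'w measure" +
  fixes \<sigma> :: "nat \<Rightarrow> 'w \<Rightarrow> real" and R :: "bool \<Rightarrow> real \<Rightarrow> 'v \<Rightarrow> 'v::euclidean_space" and x0 :: 'v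
  assumes ind: "indep_vars (\<lambda>_. borel) \<sigma> UNIV"
    and id: "\<And>i. distr M borel (\<sigma> i) = distr M borel (\<sigma> 0)"
    and R_linear: "\<And>b t. linear (R b t)"
    and R_norm: "\<And>b t v. norm (R b t v) = norm v"
    and R_continuous: "\<And>b v. continuous_on UNIV (\<lambda>t. R b t v)"
begin

text \<open>Defined on deterministic sequences of times rather than on sample points, so that
  dependence on the past alone can be expressed by restricting the sequence.\<close>

primrec state :: "nat \<Rightarrow> (nat \<Rightarrow> real) \<Rightarrow> 'v" where
  "state 0 s = x0"
| "state (Suc n) s = R (even n) (s n) (state n s)"

abbreviation x :: "nat \<Rightarrow> 'w \<Rightarrow> 'v" where
  "x n \<omega> \<equiv> state n (\<lambda>i. \<sigma> i \<omega>)"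

lemma norm_state: "norm (state n s) = norm x0"
  by (induction n) (simp_all add: R_norm)

lemma state_restrict: "n \<le> m \<Longrightarrow> state n (restrict s {..<m}) = state n s"
  by (induction n) auto

lemma measurable_sigma [measurable]: "\<sigma> i \<in> borel_measurable M"
  using ind by (auto simp: indep_vars_def)

lemma R_family: "bounded_linear_family R 1"
  by (auto simp: bounded_linear_family_def R_linear R_norm intro: borel_measurable_continuous_onI R_continuous)

lemma measurable_state: "n \<le> m \<Longrightarrow> state n \<in> borel_measurable (PiM {..<m} (\<lambda>_. borel))"
proof (induction n)
  case 0
  have "state 0 = (\<lambda>_. x0)" by auto
  then show ?case by simp
next
  case (Suc n)
  have "state (Suc n) = (\<lambda>s. R (even n) (s n) (state n s))" by auto
  moreover have "(\<lambda>s. R (even n) (s n) (state n s)) \<in> borel_measurable (PiM {..<m} (\<lambda>_. borel))"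
    by (rule measurable_bounded_linear_family[OF R_family]) (use Suc in auto)
  ultimately show ?case by simp
qed

lemma measurable_x [measurable]: "x n \<in> borel_measurable M"
  by (induction n) (auto intro!: measurable_bounded_linear_family[OF R_family])

text \<open>The mean effect of one step on a fixed vector. By independence, \<open>mean F b\<close>
  applied to the current state is the conditional mean given the past; \<open>mean R True\<close>
  and \<open>mean R False\<close> are the operators P_1 and P_2.\<close>

definition mean :: "(bool \<Rightarrow> real \<Rightarrow> 'v \<Rightarrow> 'v) \<Rightarrow> bool \<Rightarrow> 'v \<Rightarrow> 'v" where
  "mean F b v = expectation (\<lambda>\<omega>. F b (\<sigma> 0 \<omega>) v)"

lemma integrable_family:
  assumes F: "bounded_linear_family F C"
  shows "integrable M (\<lambda>\<omega>. F b (\<sigma> i \<omega>) v)"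
  by (rule integrable_const_bound[where B="C * norm v"])
    (auto intro!: measurable_bounded_linear_family[OF F] bounded_linear_familyD(2)[OF F])

lemma mean_eq:
  assumes F: "bounded_linear_family F C"
  shows "expectation (\<lambda>\<omega>. F b (\<sigma> i \<omega>) v) = mean F b v"
  unfolding mean_def
  by (rule expectation_identically_distributed[OF _ _ bounded_linear_familyD(3)[OF F] id]) measurable

lemma linear_mean:
  assumes F: "bounded_linear_family F C"
  shows "linear (mean F b)"
  unfolding mean_def
  by (rule linearI)
    (simp_all add: linear_add[OF bounded_linear_familyD(1)[OF F]]
      linear_cmul[OF bounded_linear_familyD(1)[OF F]] integrable_family[OF F])

lemma norm_mean_le:
  assumes F: "bounded_linear_family F C"
  shows "norm (mean F b v) \<le> C * norm v"
proof -
  have "norm (mean F b v) \<le> expectation (\<lambda>\<omega>. norm (F b (\<sigma> 0 \<omega>) v))"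
    unfolding mean_def by (rule integral_norm_bound)
  also have "\<dots> \<le> expectation (\<lambda>\<omega>. C * norm v)"
    by (intro integral_mono integrable_norm integrable_family[OF F] bounded_linear_familyD(2)[OF F]) auto
  finally show ?thesis by (simp add: prob_space)
qed

text \<open>The increments form a bounded martingale difference sequence. Their orthogonality is
  obtained without conditional expectations: expanded in coordinates, the inner product of two
  increments is a finite sum of a function of the past times a centred function of the current
  time.\<close>

lemma average_fluctuation_tendsto_0:
  assumes F: "bounded_linear_family F C"
  shows "AE \<omega> in M. (\<lambda>n. (\<Sum>i<n. F (even i) (\<sigma> i \<omega>) (x i \<omega>) - mean F (even i) (x i \<omega>)) /\<^sub>R real n)
    \<longlonglongrightarrow> 0"
proof -
  note Fl = bounded_linear_familyD(1)[OF F]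
  note Fm [measurable] = measurable_bounded_linear_family[OF F]
  have [measurable]: "mean F b \<in> borel_measurable borel" for b
    by (intro borel_measurable_continuous_onI linear_continuous_on linear_conv_bounded_linear[THEN iffD1]
        linear_mean[OF F])
  define D where "D = (\<lambda>i s. F (even i) (s i) (state i s) - mean F (even i) (state i s))"
  have Dbd: "norm (D i s) \<le> 2 * C * norm x0" for i s
  proof -
    have "norm (D i s) \<le> C * norm (state i s) + C * norm (state i s)"
      unfolding D_def
      by (intro order_trans[OF norm_triangle_ineq4] add_mono bounded_linear_familyD(2)[OF F] norm_mean_le[OF F])
    then show ?thesis by (simp add: norm_state)
  qed
  have DM: "(\<lambda>\<omega>. D i (\<lambda>i. \<sigma> i \<omega>)) \<in> borel_measurable M" for i
    unfolding D_def by measurable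
  have DP: "D i \<in> borel_measurable (PiM {..<j} (\<lambda>_. borel))" if "i < j" for i j
  proof -
    have [measurable]: "state i \<in> borel_measurable (PiM {..<j} (\<lambda>_. borel))"
      using that by (intro measurable_state) auto
    have [measurable]: "(\<lambda>s. s i) \<in> borel_measurable (PiM {..<j} (\<lambda>_. borel))"
      using that by (intro measurable_component_singleton) auto
    show ?thesis unfolding D_def by measurable
  qed
  have "expectation (\<lambda>\<omega>. D i (\<lambda>i. \<sigma> i \<omega>) \<bullet> D j (\<lambda>i. \<sigma> i \<omega>)) = 0" if ij: "i < j" for i j
  proof -
    let ?F = "\<lambda>t v. F (even j) t v - mean F (even j) v"
    \<comment> \<open>For a pair \<open>e\<close> of basis vectors, \<open>A e\<close> collects what
      depends on the times before \<open>j\<close> and \<open>g e\<close> what depends on the time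
      \<open>j\<close> alone.\<close>
    define A where "A = (\<lambda>e s. (state j s \<bullet> fst e) * (D i s \<bullet> snd e))"
    define g where "g = (\<lambda>e t. ?F t (fst e) \<bullet> snd e)"
    have linF: "linear (?F t)" for t
      by (intro linear_compose_sub Fl linear_mean[OF F])
    have Dj: "D i s \<bullet> D j s = (\<Sum>e\<in>Basis \<times> Basis. A e s * g e (s j))" for s
    proof -
      have "D i s \<bullet> D j s = (\<Sum>b\<in>Basis. (state j s \<bullet> b) * (D i s \<bullet> ?F (s j) b))"
      proof -
        have "D j s = ?F (s j) (state j s)" by (simp add: D_def)
        also have "\<dots> = (\<Sum>b\<in>Basis. (state j s \<bullet> b) *\<^sub>R ?F (s j) b)"
          by (rule linear_expand_Basis[OF linF])
        finally show ?thesis by (simp only: inner_sum_right inner_scaleR_right)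
      qed
      also have "\<dots> = (\<Sum>b\<in>Basis. \<Sum>c\<in>Basis. A (b, c) s * g (b, c) (s j))"
        by (intro sum.cong refl, subst euclidean_inner)
          (simp only: A_def g_def fst_conv snd_conv sum_distrib_left mult.assoc)
      finally show ?thesis by (simp add: sum.cartesian_product case_prod_beta')
    qed
    have Ameas: "A e \<in> borel_measurable (PiM {..<j} (\<lambda>_. borel))" for e
      unfolding A_def using DP[OF ij] measurable_state[of j j] by measurable
    have gmeas [measurable]: "g e \<in> borel_measurable borel" for e
      unfolding g_def using bounded_linear_familyD(3)[OF F] by measurable
    have gint: "integrable M (\<lambda>\<omega>. g e (\<sigma> j \<omega>))" for e
      unfolding g_def by (intro integrable_inner_left Bochner_Integration.integrable_diff integrable_family[OF F]) auto
    have g0: "expectation (\<lambda>\<omega>. g e (\<sigma> j \<omega>)) = 0" for e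
    proof -
      have "expectation (\<lambda>\<omega>. g e (\<sigma> j \<omega>)) = expectation (\<lambda>\<omega>. ?F (\<sigma> j \<omega>) (fst e)) \<bullet> snd e"
        unfolding g_def by (intro integral_inner_left Bochner_Integration.integrable_diff integrable_family[OF F]) auto
      also have "expectation (\<lambda>\<omega>. ?F (\<sigma> j \<omega>) (fst e)) = 0"
        using integrable_family[OF F] mean_eq[OF F] by (simp add: prob_space)
      finally show ?thesis by simp
    qed
    have Abd: "\<bar>A e s\<bar> \<le> (norm x0 * norm (fst e)) * ((2 * C * norm x0) * norm (snd e))" for e s
      unfolding A_def abs_mult
      by (intro mult_mono order_trans[OF Cauchy_Schwarz_ineq2] mult_right_mono Dbd)
        (auto simp: norm_state intro: order_trans[OF norm_ge_zero Dbd])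
    have Aint: "integrable M (\<lambda>\<omega>. A e (restrict (\<lambda>i. \<sigma> i \<omega>) {..<j}))" for e
      by (rule integrable_const_bound[OF AE_I2[OF Abd[folded real_norm_def]]])
        (intro measurable_compose[OF _ Ameas] measurable_restrict, simp)
    have Ar: "A e (restrict s {..<j}) = A e s" for e s
      using ij by (simp add: A_def D_def state_restrict)
    have "expectation (\<lambda>\<omega>. A e (\<lambda>i. \<sigma> i \<omega>) * g e (\<sigma> j \<omega>)) = 0" for e
      using indep_vars_expectation_past[OF ind Ameas gmeas Aint gint, of e e] unfolding Ar g0 by simp
    moreover have "integrable M (\<lambda>\<omega>. A e (\<lambda>i. \<sigma> i \<omega>) * g e (\<sigma> j \<omega>))" for e
    proof (rule Bochner_Integration.integrable_bound)
      show "integrable M (\<lambda>\<omega>. (norm x0 * norm (fst e)) * ((2 * C * norm x0) * norm (snd e)) * \<bar>g e (\<sigma> j \<omega>)\<bar>)"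
        using gint[of e] by (intro integrable_mult_right integrable_abs)
      show "(\<lambda>\<omega>. A e (\<lambda>i. \<sigma> i \<omega>) * g e (\<sigma> j \<omega>)) \<in> borel_measurable M"
        using Aint[unfolded Ar, of e] gint[of e] by (intro borel_measurable_times) auto
      have "norm (A e (\<lambda>i. \<sigma> i \<omega>) * g e (\<sigma> j \<omega>))
          \<le> (norm x0 * norm (fst e)) * ((2 * C * norm x0) * norm (snd e)) * \<bar>g e (\<sigma> j \<omega>)\<bar>" for \<omega>
        unfolding real_norm_def abs_mult[of "A e _"] by (rule mult_right_mono[OF Abd abs_ge_zero])
      then show "AE \<omega> in M. norm (A e (\<lambda>i. \<sigma> i \<omega>) * g e (\<sigma> j \<omega>))
          \<le> norm ((norm x0 * norm (fst e)) * ((2 * C * norm x0) * norm (snd e)) * \<bar>g e (\<sigma> j \<omega>)\<bar>)"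
        by (intro AE_I2) (metis abs_ge_self order_trans real_norm_def)
    qed
    ultimately show ?thesis unfolding Dj by simp
  qed
  then have "AE \<omega> in M. (\<lambda>n. (\<Sum>i<n. D i (\<lambda>i. \<sigma> i \<omega>)) /\<^sub>R real n) \<longlonglongrightarrow> 0"
    by (rule bounded_orthogonal_strong_law[OF DM Dbd])
  then show ?thesis unfolding D_def .
qed

end


section \<open>Averages of the states over even and odd steps\<close>

context random_switching
begin

text \<open>Padding with 0 keeps both classes on the same index range, so that both sums are divided
  by the same total number of steps.\<close>

definition parity_sum :: "bool \<Rightarrow> nat \<Rightarrow> 'w \<Rightarrow> 'v" where
  "parity_sum b n \<omega> = (\<Sum>i<n. if even i = b then x i \<omega> else 0)"

text \<open>A state of one parity is the image of its predecessor, which has the other parity.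
  Applying the fluctuation result to the step map switched off on the other parity therefore
  compares the two parity sums, up to an index shift.\<close>

lemma parity_sum_step:
  "AE \<omega> in M. (\<lambda>n. parity_sum (\<not> b) n \<omega> /\<^sub>R real n - mean R b (parity_sum b n \<omega> /\<^sub>R real n)) \<longlonglongrightarrow> 0"
proof -
  define F where "F = (\<lambda>b' t v. if b' = b then R b' t v else 0)"
  have F: "bounded_linear_family F 1"
    unfolding bounded_linear_family_def
  proof (intro conjI allI)
    note R = bounded_linear_familyD[OF R_family]
    show "linear (F b' t)" for b' t
      unfolding F_def using R(1) by (cases "b' = b") (simp_all add: linear_zero)
    show "norm (F b' t v) \<le> 1 * norm v" for b' t v
      unfolding F_def using R(2) by auto
    show "(\<lambda>t. F b' t v) \<in> borel_measurable borel" for b' v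
      unfolding F_def using R(3) by (cases "b' = b") simp_all
  qed
  have mF: "mean F b' v = (if b' = b then mean R b v else 0)" for b' v
    by (simp add: mean_def F_def)
  note lin = linear_mean[OF R_family, of b]
  show ?thesis using average_fluctuation_tendsto_0[OF F]
  proof eventually_elim
    case (elim \<omega>)
    define h where "h = (\<lambda>i. if even i = (\<not> b) then x i \<omega> else 0)"
    \<comment> \<open>Boundary term of the shift from \<open>i\<close> to \<open>i + 1\<close>; it
      is bounded and disappears after division by \<open>n\<close>.\<close>
    define e where "e = (\<lambda>n. h 0 - h n)"
    have step: "(\<Sum>i<n. F (even i) (\<sigma> i \<omega>) (x i \<omega>)) = parity_sum (\<not> b) n \<omega> - e n" for n
    proof -
      have "(\<Sum>i<n. F (even i) (\<sigma> i \<omega>) (x i \<omega>)) = (\<Sum>i<n. h (Suc i))"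
        by (intro sum.cong refl) (simp add: F_def h_def)
      also have "\<dots> = (\<Sum>i<n. h i) - e n"
        using sum.lessThan_Suc_shift[of h n] by (simp add: e_def algebra_simps)
      finally show ?thesis by (simp add: parity_sum_def h_def)
    qed
    have "(\<Sum>i<n. mean F (even i) (x i \<omega>)) = mean R b (parity_sum b n \<omega>)" for n
      unfolding parity_sum_def linear_sum[OF lin] by (intro sum.cong refl) (simp add: mF linear_0[OF lin])
    then have eq: "(\<Sum>i<n. F (even i) (\<sigma> i \<omega>) (x i \<omega>) - mean F (even i) (x i \<omega>)) /\<^sub>R real n + e n /\<^sub>R real n
        = parity_sum (\<not> b) n \<omega> /\<^sub>R real n - mean R b (parity_sum b n \<omega> /\<^sub>R real n)" for n
      by (simp add: sum_subtractf step linear_cmul[OF lin] scaleR_diff_right)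
    have "norm (e n) \<le> 2 * norm x0" for n
      unfolding e_def h_def by (rule order_trans[OF norm_triangle_ineq4]) (simp add: norm_state)
    then have "norm (e n /\<^sub>R real n) \<le> 2 * norm x0 / real n" for n
      by (simp add: divide_inverse mult.commute mult_left_mono)
    then have "(\<lambda>n. e n /\<^sub>R real n) \<longlonglongrightarrow> 0"
      by (intro Lim_null_comparison[OF always_eventually lim_const_over_n]) auto
    from tendsto_add[OF elim this] show ?case unfolding eq by simp
  qed
qed

text \<open>Equality case of strict convexity. With y the mean, isometry gives E |R v - y|^2 = 2
  |v|^2 - 2 |y|^2 = 0, so R v = y almost surely. The set of times where this holds is closed by
  continuity, and full support extends it to every nonnegative time.\<close>

lemma R_eq_mean_of_norm_mean:
  assumes support: "\<And>A t. closed A \<Longrightarrow> AE \<omega> in M. \<sigma> 0 \<omega> \<in> A \<Longrightarrow> 0 \<le> t \<Longrightarrow> t \<in> A"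
    and eq: "norm (mean R b v) = norm v" and "0 \<le> t"
  shows "R b t v = mean R b v"
proof -
  define y where "y = mean R b v"
  have int: "integrable M (\<lambda>\<omega>. R b (\<sigma> 0 \<omega>) v \<bullet> y)"
    using integrable_family[OF R_family] by auto
  have ey: "(norm (R b (\<sigma> 0 \<omega>) v - y))\<^sup>2 = 2 * (norm v)\<^sup>2 - 2 * (R b (\<sigma> 0 \<omega>) v \<bullet> y)" for \<omega>
  proof -
    have "R b (\<sigma> 0 \<omega>) v \<bullet> R b (\<sigma> 0 \<omega>) v = (norm v)\<^sup>2" "y \<bullet> y = (norm v)\<^sup>2"
      by (simp_all add: power2_norm_eq_inner[symmetric] R_norm eq y_def)
    then show ?thesis
      by (simp add: power2_norm_eq_inner inner_diff_left inner_diff_right inner_commute)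
  qed
  have "expectation (\<lambda>\<omega>. R b (\<sigma> 0 \<omega>) v \<bullet> y) = (norm v)\<^sup>2"
    using integrable_family[OF R_family]
    by (simp add: mean_def[symmetric] y_def power2_norm_eq_inner[symmetric] eq)
  then have "expectation (\<lambda>\<omega>. (norm (R b (\<sigma> 0 \<omega>) v - y))\<^sup>2) = 0"
    unfolding ey using int by (simp add: prob_space)
  moreover have "integrable M (\<lambda>\<omega>. (norm (R b (\<sigma> 0 \<omega>) v - y))\<^sup>2)"
    unfolding ey using int by auto
  ultimately have "AE \<omega> in M. (norm (R b (\<sigma> 0 \<omega>) v - y))\<^sup>2 = 0"
    by (subst (asm) integral_nonneg_eq_0_iff_AE) auto
  then have "AE \<omega> in M. \<sigma> 0 \<omega> \<in> {t. R b t v = y}" by simp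
  moreover have "closed {t. R b t v = y}"
    by (intro closed_Collect_eq R_continuous continuous_on_const)
  ultimately show ?thesis using support[of "{t. R b t v = y}" t] \<open>0 \<le> t\<close> by (simp add: y_def)
qed

end

text \<open>The conserved quantity \<open>L\<close> cuts out the subspace on which there are no common fixed vectors;
  for density matrices it is the trace.\<close>

locale mixing_switching = random_switching M \<sigma> R x0
  for M :: "'w measure" and \<sigma> and R :: "bool \<Rightarrow> real \<Rightarrow> 'v \<Rightarrow> 'v::euclidean_space" and x0 +
  fixes L :: "'v \<Rightarrow> 'u::euclidean_space"
  assumes support: "\<And>A t. closed A \<Longrightarrow> AE \<omega> in M. \<sigma> 0 \<omega> \<in> A \<Longrightarrow> 0 \<le> t \<Longrightarrow> t \<in> A"
    and pos: "AE \<omega> in M. 0 < \<sigma> 0 \<omega>" and integrable: "integrable M (\<sigma> 0)"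
    and L_linear: "linear L" and L_R: "\<And>b t v. L (R b t v) = L v" and L_x0: "L x0 = 0"
    and fixed_eq_0: "\<And>v. (\<And>s t. 0 \<le> s \<Longrightarrow> 0 \<le> t \<Longrightarrow> R False t (R True s v) = v) \<Longrightarrow> L v = 0 \<Longrightarrow> v = 0"
begin

text \<open>Both means are contractions, so a vector fixed by their product loses norm at neither
  stage, and the equality case applies twice.\<close>

lemma mean_fixed_eq_0:
  assumes eq: "mean R False (mean R True v) = v" and "L v = 0"
  shows "v = 0"
proof (rule fixed_eq_0[OF _ \<open>L v = 0\<close>])
  fix s t :: real assume st: "0 \<le> s" "0 \<le> t"
  have le: "norm (mean R True v) \<le> norm v" "norm v \<le> norm (mean R True v)"
    using norm_mean_le[OF R_family, of True v] norm_mean_le[OF R_family, of False "mean R True v"] eq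
    by simp_all
  have "R True s v = mean R True v"
    by (rule R_eq_mean_of_norm_mean[OF support]) (use st le in auto)
  moreover have "R False t (mean R True v) = mean R False (mean R True v)"
    by (rule R_eq_mean_of_norm_mean[OF support]) (use st le eq in auto)
  ultimately show "R False t (R True s v) = v" using eq by simp
qed

lemma L_state: "L (state n s) = 0"
  by (induction n) (simp_all add: L_R L_x0)

lemma parity_average_tendsto_0:
  "AE \<omega> in M. \<forall>b. (\<lambda>n. parity_sum b n \<omega> /\<^sub>R real n) \<longlonglongrightarrow> 0"
proof -
  define P where "P = (\<lambda>b. mean R b)"
  have linP: "linear (P b)" for b unfolding P_def by (rule linear_mean[OF R_family])
  \<comment> \<open>Pairing with \<open>L\<close> gives a map that is injective on the whole space,
    hence bounded below by finite dimension; the averages have vanishing second component because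
    \<open>L\<close> is conserved.\<close>
  define \<Phi> where "\<Phi> = (\<lambda>v. (v - P False (P True v), L v))"
  have lin\<Phi>: "linear \<Phi>"
    unfolding \<Phi>_def
    by (rule linearI)
      (simp_all add: linear_add[OF linP] linear_cmul[OF linP] linear_add[OF L_linear] linear_cmul[OF L_linear]
        scaleR_diff_right)
  have "inj \<Phi>"
    unfolding linear_injective_0[OF lin\<Phi>] using mean_fixed_eq_0 by (auto simp: \<Phi>_def P_def zero_prod_def)
  then obtain B where B: "B > 0" "\<And>v. B * norm v \<le> norm (\<Phi> v)"
    using linear_inj_bounded_below_pos[OF lin\<Phi>] by blast
  show ?thesis using parity_sum_step[of True] parity_sum_step[of False]
  proof eventually_elim
    case (elim \<omega>)
    define a where "a = (\<lambda>n. parity_sum True n \<omega> /\<^sub>R real n)"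
    define c where "c = (\<lambda>n. parity_sum False n \<omega> /\<^sub>R real n)"
    have ca: "(\<lambda>n. c n - P True (a n)) \<longlonglongrightarrow> 0" and ac: "(\<lambda>n. a n - P False (c n)) \<longlonglongrightarrow> 0"
      using elim by (simp_all add: a_def c_def P_def)
    have P0: "(\<lambda>n. P b (f n)) \<longlonglongrightarrow> 0" if "f \<longlonglongrightarrow> 0" for b and f :: "nat \<Rightarrow> 'v"
      using bounded_linear.tendsto[OF linear_conv_bounded_linear[THEN iffD1, OF linP] that, of b]
      by (simp add: linear_0[OF linP])
    have La: "L (a n) = 0" for n
      unfolding a_def parity_sum_def
      by (simp add: linear_cmul[OF L_linear] linear_sum[OF L_linear] if_distrib[of L] L_state linear_0[OF L_linear]
          cong: if_cong)
    have "(\<lambda>n. (a n - P False (c n)) + P False (c n - P True (a n))) \<longlonglongrightarrow> 0"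
      using tendsto_add[OF ac P0[OF ca]] by simp
    then have "(\<lambda>n. a n - P False (P True (a n))) \<longlonglongrightarrow> 0"
      by (simp add: linear_diff[OF linP])
    then have "(\<lambda>n. norm (\<Phi> (a n))) \<longlonglongrightarrow> 0"
      unfolding \<Phi>_def La by (simp add: norm_Pair tendsto_norm_zero)
    then have "(\<lambda>n. norm (\<Phi> (a n)) / B) \<longlonglongrightarrow> 0"
      by (rule tendsto_divide_zero)
    then have a0: "a \<longlonglongrightarrow> 0"
      by (rule Lim_null_comparison[rotated])
        (intro always_eventually allI, use B in \<open>simp add: pos_le_divide_eq mult.commute\<close>)
    have "(\<lambda>n. (c n - P True (a n)) + P True (a n)) \<longlonglongrightarrow> 0"
      using tendsto_add[OF ca P0[OF a0, of True]] by simp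
    then have "c \<longlonglongrightarrow> 0" by simp
    with a0 show ?case unfolding a_def c_def by (simp add: all_bool_eq)
  qed
qed

text \<open>The conditional means are linear in the state, so their averages are continuous images
  of the two parity averages, which vanish; the fluctuations around them vanish as well.\<close>

lemma average_tendsto_0:
  assumes F: "bounded_linear_family F C"
  shows "AE \<omega> in M. (\<lambda>n. (\<Sum>i<n. F (even i) (\<sigma> i \<omega>) (x i \<omega>)) /\<^sub>R real n) \<longlonglongrightarrow> 0"
proof -
  note lin = linear_mean[OF F]
  show ?thesis using average_fluctuation_tendsto_0[OF F] parity_average_tendsto_0
  proof eventually_elim
    case (elim \<omega>)
    have m: "(\<lambda>n. mean F b (parity_sum b n \<omega> /\<^sub>R real n)) \<longlonglongrightarrow> 0" for b
      using bounded_linear.tendsto[OF linear_conv_bounded_linear[THEN iffD1, OF lin] elim(2)[rule_format, of b], of b]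
      by (simp add: linear_0[OF lin])
    have "(\<Sum>i<n. mean F (even i) (x i \<omega>)) = mean F True (parity_sum True n \<omega>) + mean F False (parity_sum False n \<omega>)" for n
      unfolding parity_sum_def linear_sum[OF lin] sum.distrib[symmetric]
      by (intro sum.cong refl) (simp add: linear_0[OF lin])
    then have "(\<Sum>i<n. F (even i) (\<sigma> i \<omega>) (x i \<omega>) - mean F (even i) (x i \<omega>)) /\<^sub>R real n
        + (mean F True (parity_sum True n \<omega> /\<^sub>R real n) + mean F False (parity_sum False n \<omega> /\<^sub>R real n))
        = (\<Sum>i<n. F (even i) (\<sigma> i \<omega>) (x i \<omega>)) /\<^sub>R real n" for n
      by (simp add: sum_subtractf linear_cmul[OF lin] scaleR_diff_right scaleR_add_right)
    then show ?case
      using tendsto_add[OF elim(1) tendsto_add[OF m[of True] m[of False]]] by simp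
  qed
qed

end


section \<open>From switching steps to continuous time\<close>

lemma (in prob_space) bounded_iid_strong_law:
  fixes g :: "real \<Rightarrow> real"
  assumes ind: "indep_vars (\<lambda>_. borel) X UNIV"
    and id: "\<And>i. distr M borel (X i) = distr M borel (X 0)"
    and [measurable]: "g \<in> borel_measurable borel" and bd: "\<And>t. \<bar>g t\<bar> \<le> C"
  shows "AE \<omega> in M. (\<lambda>n. (\<Sum>i<n. g (X i \<omega>)) / real n) \<longlonglongrightarrow> expectation (\<lambda>\<omega>. g (X 0 \<omega>))"
proof -
  have [measurable]: "X i \<in> borel_measurable M" for i
    using ind by (auto simp: indep_vars_def)
  define m where "m = expectation (\<lambda>\<omega>. g (X 0 \<omega>))"
  define D where "D = (\<lambda>i \<omega>. g (X i \<omega>) - m)"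
  have int: "integrable M (\<lambda>\<omega>. g (X i \<omega>))" for i
    by (rule integrable_const_bound[where B=C]) (use bd in auto)
  have mi: "expectation (\<lambda>\<omega>. g (X i \<omega>)) = m" for i
    unfolding m_def by (rule expectation_identically_distributed[OF _ _ _ id]) measurable
  have "AE \<omega> in M. (\<lambda>n. (\<Sum>i<n. D i \<omega>) /\<^sub>R real n) \<longlonglongrightarrow> 0"
  proof (rule bounded_orthogonal_strong_law)
    show "D i \<in> borel_measurable M" for i unfolding D_def by measurable
    show "norm (D i \<omega>) \<le> C + \<bar>m\<bar>" for i \<omega>
      unfolding D_def real_norm_def by (rule order_trans[OF abs_triangle_ineq4]) (simp add: bd)
    show "expectation (\<lambda>\<omega>. D i \<omega> \<bullet> D j \<omega>) = 0" if "i < j" for i j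
    proof -
      have "expectation (\<lambda>\<omega>. D i \<omega> * D j \<omega>) = expectation (D i) * expectation (D j)"
        using indep_vars_expectation_past[OF ind, of "\<lambda>s. g (s i) - m" j "\<lambda>t. g t - m"] that int
        by (simp add: D_def)
      also have "expectation (D i) = 0" unfolding D_def using int mi by (simp add: prob_space)
      finally show ?thesis by simp
    qed
  qed
  then show ?thesis
  proof eventually_elim
    case (elim \<omega>)
    have "(\<Sum>i<n. D i \<omega>) /\<^sub>R real n + m = (\<Sum>i<n. g (X i \<omega>)) / real n" if "n \<ge> 1" for n
      using that by (simp add: D_def sum_subtractf field_simps)
    then have "(\<lambda>n. (\<Sum>i<n. g (X i \<omega>)) / real n) \<longlonglongrightarrow> 0 + m"
      by (intro Lim_transform_eventually[OF tendsto_add[OF elim tendsto_const]] eventually_sequentiallyI[of 1])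
    then show ?case by (simp add: m_def)
  qed
qed

context random_switching
begin

lemma R_integrable: "(\<lambda>u. R b u v) integrable_on {p..q}"
  by (rule integrable_continuous_real) (rule continuous_on_subset[OF R_continuous subset_UNIV])

lemma norm_integral_R_le: "p \<le> q \<Longrightarrow> norm (integral {p..q} (\<lambda>u. R b u v)) \<le> (q - p) * norm v"
  using integral_bound[of p q "\<lambda>u. R b u v" "norm v"] continuous_on_subset[OF R_continuous subset_UNIV]
  by (simp add: R_norm mult.commute)

text \<open>Capping the interval length at \<open>K\<close> supplies the bound uniform in
  \<open>t\<close>.\<close>

lemma truncated_integral_family:
  assumes "0 \<le> K"
  shows "bounded_linear_family (\<lambda>b t v. integral {0..min t K} (\<lambda>u. R b u v)) K"
  unfolding bounded_linear_family_def
proof (intro conjI allI)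
  show "linear (\<lambda>v. integral {0..min t K} (\<lambda>u. R b u v))" for b t
    by (rule linearI)
      (simp_all add: linear_add[OF R_linear] linear_cmul[OF R_linear] integral_add R_integrable)
  show "norm (integral {0..min t K} (\<lambda>u. R b u v)) \<le> K * norm v" for b t v
  proof (cases "0 \<le> min t K")
    case True
    then have "norm (integral {0..min t K} (\<lambda>u. R b u v)) \<le> min t K * norm v"
      using norm_integral_R_le[of 0 "min t K" b v] by simp
    also have "\<dots> \<le> K * norm v" by (intro mult_right_mono) auto
    finally show ?thesis .
  qed (use assms in simp)
  show "(\<lambda>t. integral {0..min t K} (\<lambda>u. R b u v)) \<in> borel_measurable borel" for b v
  proof (rule borel_measurable_continuous_onI)
    \<comment> \<open>For negative times the interval is empty and the integral is 0, so clipping at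
      0 changes no value while keeping the endpoint in [0, K], where the indefinite integral is
      continuous.\<close>
    have "continuous_on UNIV (\<lambda>t. integral {0..max 0 (min t K)} (\<lambda>u. R b u v))"
      by (rule continuous_on_compose2[OF indefinite_integral_continuous_1[OF R_integrable, of 0 K]])
        (use assms in \<open>auto intro!: continuous_intros\<close>)
    moreover have "integral {0..max 0 (min t K)} (\<lambda>u. R b u v) = integral {0..min t K} (\<lambda>u. R b u v)" for t
      by (cases "0 \<le> min t K") (auto simp: max_def)
    ultimately show "continuous_on UNIV (\<lambda>t. integral {0..min t K} (\<lambda>u. R b u v))" by simp
  qed
qed

lemma norm_integral_truncated_le:
  assumes "0 \<le> t" "0 \<le> K"
  shows "norm (integral {0..t} (\<lambda>u. R b u v) - integral {0..min t K} (\<lambda>u. R b u v)) \<le> max (t - K) 0 * norm v"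
proof (cases "t \<le> K")
  case False
  have "integral {0..K} (\<lambda>u. R b u v) + integral {K..t} (\<lambda>u. R b u v) = integral {0..t} (\<lambda>u. R b u v)"
    by (rule Henstock_Kurzweil_Integration.integral_combine) (use assms False R_integrable in auto)
  then have "integral {0..t} (\<lambda>u. R b u v) - integral {0..min t K} (\<lambda>u. R b u v) = integral {K..t} (\<lambda>u. R b u v)"
    using False by (simp add: algebra_simps)
  then show ?thesis using norm_integral_R_le[of K t b v] False by simp
qed simp

text \<open>Prescribes \<open>\<xi>\<close> only between consecutive switching times. The almost
  sure statement can then be quantified over all such paths and specialised to the actual evolution
  afterwards.\<close>

definition is_path :: "(nat \<Rightarrow> real) \<Rightarrow> (real \<Rightarrow> 'v) \<Rightarrow> bool" where
  "is_path s \<xi> \<longleftrightarrow> (\<forall>n u. sum s {..<n} \<le> u \<longrightarrow> u < sum s {..<Suc n} \<longrightarrow>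
     \<xi> u = R (even n) (u - sum s {..<n}) (state n s))"

lemma has_integral_path_piece:
  assumes "is_path s \<xi>" "0 \<le> d" "d \<le> s n"
  shows "(\<xi> has_integral integral {0..d} (\<lambda>u. R (even n) u (state n s))) {sum s {..<n}..sum s {..<n} + d}"
proof -
  let ?t = "sum s {..<n}" and ?f = "\<lambda>u. R (even n) u (state n s)"
  have "(?f has_integral integral {0..d} ?f) (cbox 0 d)"
    using R_integrable by (simp add: integrable_integral)
  from has_integral_affinity'[OF this, of 1 "- ?t"]
  have "((\<lambda>u. ?f (u - ?t)) has_integral integral {0..d} ?f) {?t..?t + d}"
    by (simp add: add.commute)
  then show ?thesis
  \<comment> \<open>If \<open>d\<close> is the full length of the interval, the right endpoint
    already belongs to the next piece; one point does not affect the integral.\<close>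
  proof (rule has_integral_spike_finite[rotated 2])
    show "\<xi> u = ?f (u - ?t)" if "u \<in> {?t..?t + d} - {?t + d}" for u
      using that assms by (auto simp: is_path_def)
  qed simp
qed

lemma has_integral_path:
  assumes path: "is_path s \<xi>" and s: "\<And>i. 0 \<le> s i" and d: "0 \<le> d" "d \<le> s n"
  shows "(\<xi> has_integral (\<Sum>i<n. integral {0..s i} (\<lambda>u. R (even i) u (state i s)))
      + integral {0..d} (\<lambda>u. R (even n) u (state n s))) {0..sum s {..<n} + d}"
proof -
  have t0: "0 \<le> sum s {..<n}" for n by (simp add: s sum_nonneg)
  have "(\<xi> has_integral (\<Sum>i<n. integral {0..s i} (\<lambda>u. R (even i) u (state i s)))) {0..sum s {..<n}}" for n
  proof (induction n)
    case (Suc n)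
    show ?case
      using has_integral_combine[OF t0 _ Suc has_integral_path_piece[OF path, of "s n" n]] s[of n]
      by simp
  qed (simp add: has_integral_refl)
  from has_integral_combine[OF t0 _ this has_integral_path_piece[OF path d]] d show ?thesis by simp
qed

text \<open>Purely deterministic. For T in the interval with index n, the integral up to T is the
  sum over n full intervals plus a rest of norm at most \<open>s n * norm x0\<close>. Both are o(n),
  while T is at least c n.\<close>

lemma path_average_tendsto_0:
  assumes path: "is_path s \<xi>" and s: "\<And>i. 0 \<le> s i" and "0 < c"
    and lower: "\<forall>\<^sub>F n in sequentially. c * real n \<le> sum s {..<n}"
    and I0: "(\<lambda>n. (\<Sum>i<n. integral {0..s i} (\<lambda>u. R (even i) u (state i s))) /\<^sub>R real n) \<longlonglongrightarrow> 0"
    and s0: "(\<lambda>n. s n / real n) \<longlonglongrightarrow> 0"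
  shows "((\<lambda>T. integral {0..T} \<xi> /\<^sub>R T) \<longlongrightarrow> 0) at_top"
    and "\<And>T. 0 \<le> T \<Longrightarrow> \<xi> integrable_on {0..T}"
proof -
  define I where "I = (\<lambda>n. \<Sum>i<n. integral {0..s i} (\<lambda>u. R (even i) u (state i s)))"
  define t where "t = (\<lambda>n. sum s {..<n})"
  have mono: "t m \<le> t n" if "m \<le> n" for m n
    unfolding t_def by (rule sum_mono2) (use that s in auto)
  obtain N0 where N0: "\<And>n. n \<ge> N0 \<Longrightarrow> c * real n \<le> t n"
    using lower by (auto simp: eventually_sequentially t_def)
  have ex: "\<exists>n. t n \<le> T \<and> T < t (Suc n)" if "0 \<le> T" for T
  proof -
    obtain k :: nat where "T / c < real k" using reals_Archimedean2 by blast
    then have "T < c * real k" using \<open>0 < c\<close> by (simp add: pos_divide_less_eq mult.commute)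
    also have "\<dots> \<le> c * real (max k N0)" using \<open>0 < c\<close> by simp
    also have "\<dots> \<le> t (max k N0)" by (rule N0) simp
    finally have "\<exists>n. T < t n" by blast
    moreover have "\<not> T < t 0" using that by (simp add: t_def)
    ultimately show ?thesis
      using ex_least_nat_less[of "\<lambda>n. T < t n"] by (metis less_Suc_eq_le linorder_not_less order_refl)
  qed
  have int: "(\<xi> has_integral I n + integral {0..T - t n} (\<lambda>u. R (even n) u (state n s))) {0..T}"
    if "t n \<le> T" "T < t (Suc n)" for n T
    using has_integral_path[OF path s, of "T - t n" n] that by (simp add: I_def t_def)
  show "\<xi> integrable_on {0..T}" if "0 \<le> T" for T
    using ex[OF that] int by blast
  show "((\<lambda>T. integral {0..T} \<xi> /\<^sub>R T) \<longlongrightarrow> 0) at_top"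
  proof (rule tendstoI)
    fix \<epsilon> :: real assume "\<epsilon> > 0"
    define y where "y = 1 + norm x0"
    \<comment> \<open>The full intervals contribute at most \<open>\<delta> * n\<close> and the rest
      \<open>\<delta> * n * norm x0\<close>, in total \<open>\<delta> * n * y\<close>, which this
      choice makes \<epsilon>/2 times c n.\<close>
    define \<delta> where "\<delta> = \<epsilon> * c / (2 * y)"
    have x1: "0 < y" by (simp add: y_def add_pos_nonneg)
    have "\<delta> > 0" unfolding \<delta>_def using \<open>\<epsilon> > 0\<close> \<open>0 < c\<close> x1 by simp
    have "\<forall>\<^sub>F n in sequentially. dist (I n /\<^sub>R real n) 0 < \<delta> \<and> dist (s n / real n) 0 < \<delta>"
      using tendstoD[OF I0 \<open>\<delta> > 0\<close>] tendstoD[OF s0 \<open>\<delta> > 0\<close>] unfolding I_def by eventually_elim simp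
    then obtain N1 where N1: "\<And>n. n \<ge> N1 \<Longrightarrow> dist (I n /\<^sub>R real n) 0 < \<delta> \<and> dist (s n / real n) 0 < \<delta>"
      by (auto simp: eventually_sequentially)
    define N where "N = max (max N0 N1) 1"
    show "\<forall>\<^sub>F T in at_top. dist (integral {0..T} \<xi> /\<^sub>R T) 0 < \<epsilon>"
    proof (rule eventually_at_top_linorderI[of "t N"])
      fix T assume T: "t N \<le> T"
      have "0 \<le> T" using T mono[of 0 N] by (simp add: t_def)
      then obtain n where n: "t n \<le> T" "T < t (Suc n)" using ex by blast
      have "n \<ge> N"
      proof (rule ccontr)
        assume "\<not> n \<ge> N"
        then have "t (Suc n) \<le> t N" by (intro mono) simp
        then show False using n T by simp
      qed
      then have n': "n \<ge> N0" "n \<ge> N1" "n \<ge> 1" by (auto simp: N_def)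
      have "norm (I n) \<le> \<delta> * real n"
        using N1[OF n'(2)] n'(3) by (simp add: field_simps)
      moreover have "s n \<le> \<delta> * real n"
        using N1[OF n'(2)] n'(3) s[of n] by (simp add: field_simps)
      moreover have "norm (integral {0..T - t n} (\<lambda>u. R (even n) u (state n s))) \<le> s n * norm x0"
      proof -
        have "norm (integral {0..T - t n} (\<lambda>u. R (even n) u (state n s))) \<le> (T - t n) * norm x0"
          using norm_integral_R_le[of 0 "T - t n" "even n" "state n s"] n by (simp add: norm_state)
        also have "\<dots> \<le> s n * norm x0"
          using n by (intro mult_right_mono) (simp_all add: t_def)
        finally show ?thesis .
      qed
      moreover have "s n * norm x0 \<le> \<delta> * real n * norm x0"
        using \<open>s n \<le> \<delta> * real n\<close> by (rule mult_right_mono) simp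
      moreover have "norm (integral {0..T} \<xi>)
          \<le> norm (I n) + norm (integral {0..T - t n} (\<lambda>u. R (even n) u (state n s)))"
        using integral_unique[OF int[OF n]] norm_triangle_ineq by metis
      ultimately have "norm (integral {0..T} \<xi>) \<le> \<delta> * real n * y"
        by (simp add: y_def distrib_left)
      also have "\<dots> = \<epsilon> / 2 * (c * real n)" using x1 by (simp add: \<delta>_def)
      also have "\<dots> \<le> \<epsilon> / 2 * T"
        using N0[OF n'(1)] n(1) \<open>\<epsilon> > 0\<close> by (intro mult_left_mono) auto
      finally have le: "norm (integral {0..T} \<xi>) \<le> \<epsilon> / 2 * T" .
      have "0 < c * real n" using \<open>0 < c\<close> n'(3) by simp
      then have "0 < T" using N0[OF n'(1)] n(1) by linarith
      then have "norm (integral {0..T} \<xi> /\<^sub>R T) \<le> \<epsilon> / 2"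
        using le by (simp add: field_simps)
      then show "dist (integral {0..T} \<xi> /\<^sub>R T) 0 < \<epsilon>" using \<open>\<epsilon> > 0\<close> by simp
    qed
  qed
qed

end

section \<open>Almost sure growth of the switching times and path averages\<close>

context mixing_switching
begin

lemma AE_pos: "AE \<omega> in M. \<forall>i. 0 < \<sigma> i \<omega>"
  unfolding AE_all_countable
proof
  fix i
  have "AE t in distr M borel (\<sigma> 0). 0 < t"
    using pos by (subst AE_distr_iff) auto
  then have "AE t in distr M borel (\<sigma> i). 0 < t" unfolding id[of i] .
  then show "AE \<omega> in M. 0 < \<sigma> i \<omega>" by (subst (asm) AE_distr_iff) auto
qed

text \<open>A lower bound survives clipping the times to [0, 1], which brings them under the bounded
  strong law; the clipped mean is positive because the times are almost surely positive.\<close>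

lemma ex_linear_lower_bound:
  "\<exists>c>0. AE \<omega> in M. \<forall>\<^sub>F n in sequentially. c * real n \<le> (\<Sum>i<n. \<sigma> i \<omega>)"
proof -
  define g where "g = (\<lambda>t::real. max 0 (min t 1))"
  define m where "m = expectation (\<lambda>\<omega>. g (\<sigma> 0 \<omega>))"
  have [measurable]: "g \<in> borel_measurable borel" unfolding g_def by measurable
  have gbd: "\<bar>g t\<bar> \<le> 1" for t by (auto simp: g_def)
  have int: "integrable M (\<lambda>\<omega>. g (\<sigma> 0 \<omega>))"
    by (rule integrable_const_bound[where B=1]) (use gbd in auto)
  have "m \<noteq> 0"
  proof
    assume "m = 0"
    then have "AE \<omega> in M. g (\<sigma> 0 \<omega>) = 0"
      unfolding m_def using int by (subst (asm) integral_nonneg_eq_0_iff_AE) (auto simp: g_def)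
    with pos have "AE \<omega> in M. False" by eventually_elim (auto simp: g_def)
    then show False by simp
  qed
  moreover have "m \<ge> 0" unfolding m_def by (rule Bochner_Integration.integral_nonneg) (auto simp: g_def)
  ultimately have "m > 0" by simp
  have "AE \<omega> in M. \<forall>\<^sub>F n in sequentially. m / 2 * real n \<le> (\<Sum>i<n. \<sigma> i \<omega>)"
    using AE_pos bounded_iid_strong_law[OF ind id \<open>g \<in> _\<close> gbd]
  proof eventually_elim
    case (elim \<omega>)
    have "\<forall>\<^sub>F n in sequentially. m / 2 < (\<Sum>i<n. g (\<sigma> i \<omega>)) / real n"
      by (rule order_tendstoD(1)[OF elim(2)]) (use \<open>m > 0\<close> in \<open>simp add: m_def\<close>)
    with eventually_gt_at_top[of 0] show ?case
    proof eventually_elim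
      fix n :: nat assume n: "0 < n" "m / 2 < (\<Sum>i<n. g (\<sigma> i \<omega>)) / real n"
      then have "m / 2 * real n \<le> (\<Sum>i<n. g (\<sigma> i \<omega>))" by (simp add: field_simps)
      also have "\<dots> \<le> (\<Sum>i<n. \<sigma> i \<omega>)"
        using elim(1) by (intro sum_mono) (auto simp: g_def less_imp_le)
      finally show "m / 2 * real n \<le> (\<Sum>i<n. \<sigma> i \<omega>)" .
    qed
  qed
  then show ?thesis using \<open>m > 0\<close> by (intro exI[of _ "m / 2"]) auto
qed

lemma ex_excess_bound:
  "\<exists>\<delta>. \<delta> \<longlonglongrightarrow> 0 \<and> (AE \<omega> in M. \<forall>K. \<forall>\<^sub>F n in sequentially.
     (\<Sum>i<n. max (\<sigma> i \<omega> - real K) 0) \<le> real n * \<delta> K)"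
proof -
  define Z where "Z = (\<lambda>K i \<omega>. max (\<sigma> i \<omega> - real K) 0)"
  \<comment> \<open>The term 1 / (K + 1) is the positive slack that the one-sided strong law
    demands; it vanishes together with the expected excess. Integer levels keep the number of null
    sets countable.\<close>
  define \<delta> where "\<delta> = (\<lambda>K. 2 * expectation (Z K 0) + 1 / real (Suc K))"
  have [measurable]: "Z K i \<in> borel_measurable M" for K i unfolding Z_def by measurable
  have int: "integrable M (Z K 0)" for K
    by (rule Bochner_Integration.integrable_bound[OF integrable]) (auto simp: Z_def)
  have "AE \<omega> in M. \<forall>\<^sub>F n in sequentially. (\<Sum>i<n. Z K i \<omega>) \<le> real n * \<delta> K" for K
    unfolding \<delta>_def
  proof (rule iid_average_eventually_le)
    show "indep_vars (\<lambda>_. borel) (Z K) UNIV"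
      unfolding Z_def by (rule indep_vars_compose2[OF ind, where Y="\<lambda>_ t. max (t - real K) 0"]) measurable
    have "distr M borel (Z K i) = distr (distr M borel (\<sigma> i)) borel (\<lambda>t. max (t - real K) 0)" for i
      unfolding Z_def by (subst distr_distr) (auto simp: o_def)
    then show "distr M borel (Z K i) = distr M borel (Z K 0)" for i using id[of i] by simp
  qed (auto simp: int, auto simp: Z_def)
  then have "AE \<omega> in M. \<forall>K. \<forall>\<^sub>F n in sequentially. (\<Sum>i<n. Z K i \<omega>) \<le> real n * \<delta> K"
    by (simp add: AE_all_countable)
  moreover have "(\<lambda>K. expectation (Z K 0)) \<longlonglongrightarrow> expectation (\<lambda>_. 0)"
  proof (rule integral_dominated_convergence[where w="\<lambda>\<omega>. \<bar>\<sigma> 0 \<omega>\<bar>"])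
    have "(\<lambda>K. Z K 0 \<omega>) \<longlonglongrightarrow> 0" for \<omega>
    proof (rule tendsto_eventually, rule eventually_sequentiallyI)
      fix K assume "nat \<lceil>\<sigma> 0 \<omega>\<rceil> \<le> K"
      then show "Z K 0 \<omega> = 0" by (simp add: Z_def nat_le_iff ceiling_le_iff)
    qed
    then show "AE \<omega> in M. (\<lambda>K. Z K 0 \<omega>) \<longlonglongrightarrow> 0" by simp
    show "AE \<omega> in M. norm (Z K 0 \<omega>) \<le> \<bar>\<sigma> 0 \<omega>\<bar>" for K by (auto simp: Z_def)
  qed (use integrable in auto)
  then have "\<delta> \<longlonglongrightarrow> 2 * 0 + 0"
    unfolding \<delta>_def by (intro tendsto_add tendsto_mult_left LIMSEQ_Suc lim_1_over_n) simp
  ultimately show ?thesis unfolding Z_def by auto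
qed

text \<open>Truncated and full interval integrals differ by at most the total excess times
  \<open>norm x0\<close>. The level \<open>K\<close> is chosen first to make this at most
  \<epsilon>/2 per step, then \<open>n\<close> grows. Integrability is recorded because the final
  argument takes a linear functional out of the integral.\<close>

lemma path_average:
  "AE \<omega> in M. \<forall>\<xi>. is_path (\<lambda>i. \<sigma> i \<omega>) \<xi> \<longrightarrow>
     ((\<lambda>T. integral {0..T} \<xi> /\<^sub>R T) \<longlongrightarrow> 0) at_top \<and> (\<forall>T\<ge>0. \<xi> integrable_on {0..T})"
proof -
  obtain c where c: "c > 0" "AE \<omega> in M. \<forall>\<^sub>F n in sequentially. c * real n \<le> (\<Sum>i<n. \<sigma> i \<omega>)"
    using ex_linear_lower_bound by blast
  obtain \<delta> where \<delta>: "\<delta> \<longlonglongrightarrow> 0" "AE \<omega> in M. \<forall>K. \<forall>\<^sub>F n in sequentially.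
     (\<Sum>i<n. max (\<sigma> i \<omega> - real K) 0) \<le> real n * \<delta> K"
    using ex_excess_bound by blast
  have "AE \<omega> in M. \<forall>K::nat. (\<lambda>n. (\<Sum>i<n. integral {0..min (\<sigma> i \<omega>) (real K)} (\<lambda>u. R (even i) u (x i \<omega>)))
      /\<^sub>R real n) \<longlonglongrightarrow> 0"
    unfolding AE_all_countable using average_tendsto_0[OF truncated_integral_family] by simp
  with c(2) \<delta>(2) AE_pos show ?thesis
  proof eventually_elim
    case (elim \<omega>)
    let ?s = "\<lambda>i. \<sigma> i \<omega>"
    define E where "E = (\<lambda>K n. \<Sum>i<n. max (?s i - real K) 0)"
    define I where "I = (\<lambda>n. \<Sum>i<n. integral {0..?s i} (\<lambda>u. R (even i) u (x i \<omega>)))"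
    define J where "J = (\<lambda>K n. \<Sum>i<n. integral {0..min (?s i) (real K)} (\<lambda>u. R (even i) u (x i \<omega>)))"
    have s: "0 \<le> ?s i" for i using elim(3) less_imp_le by blast
    have E0: "\<forall>\<^sub>F n in sequentially. E K n \<le> real n * \<delta> K" for K using elim(2) by (simp add: E_def)
    have IJ: "norm (I n - J K n) \<le> E K n * norm x0" for K n
    proof -
      have "norm (I n - J K n) \<le> (\<Sum>i<n. max (?s i - real K) 0 * norm x0)"
        unfolding I_def J_def sum_subtractf[symmetric]
        by (rule sum_norm_le) (metis norm_integral_truncated_le s norm_state of_nat_0_le_iff)
      then show ?thesis by (simp add: E_def sum_distrib_right)
    qed
    have nr: "norm (v /\<^sub>R real n) = norm v / real n" for v :: 'v and n
      by (simp only: norm_scaleR abs_inverse abs_of_nat divide_inverse mult.commute)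
    have I0: "(\<lambda>n. I n /\<^sub>R real n) \<longlonglongrightarrow> 0"
    proof (rule tendstoI)
      fix \<epsilon> :: real assume "\<epsilon> > 0"
      have "(\<lambda>K. \<delta> K * norm x0) \<longlonglongrightarrow> 0" using tendsto_mult_left_zero[OF \<delta>(1)] .
      from order_tendstoD(2)[OF this, of "\<epsilon> / 2"] \<open>\<epsilon> > 0\<close>
      obtain K where K: "\<delta> K * norm x0 < \<epsilon> / 2" by (auto simp: eventually_sequentially)
      have "\<forall>\<^sub>F n in sequentially. norm (J K n /\<^sub>R real n) < \<epsilon> / 2"
        using tendstoD[OF elim(4)[rule_format, of K], of "\<epsilon> / 2"] \<open>\<epsilon> > 0\<close> by (simp add: J_def)
      with E0[of K] eventually_gt_at_top[of 0]
      show "\<forall>\<^sub>F n in sequentially. dist (I n /\<^sub>R real n) 0 < \<epsilon>"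
      proof eventually_elim
        fix n :: nat assume n: "E K n \<le> real n * \<delta> K" "0 < n" "norm (J K n /\<^sub>R real n) < \<epsilon> / 2"
        have "norm (I n) \<le> norm (J K n) + norm (I n - J K n)" by (rule norm_triangle_sub)
        also have "norm (I n - J K n) \<le> real n * \<delta> K * norm x0"
          by (rule order_trans[OF IJ mult_right_mono[OF n(1)]]) simp
        finally have "norm (I n) / real n \<le> norm (J K n) / real n + \<delta> K * norm x0"
          using n(2) by (simp add: field_simps)
        also have "\<dots> < \<epsilon> / 2 + \<epsilon> / 2"
          using n(3) K unfolding nr by (rule add_strict_mono)
        finally show "dist (I n /\<^sub>R real n) 0 < \<epsilon>" unfolding dist_norm diff_0_right nr by linarith
      qed
    qed
    \<comment> \<open>A single excess is at most the sum of the first n + 1, so the excess bound at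
      index n + 1 gives s n \<le> K + (n + 1) \<open>\<delta> K\<close>.\<close>
    have s0: "(\<lambda>n. ?s n / real n) \<longlonglongrightarrow> 0"
    proof (rule tendstoI)
      fix \<epsilon> :: real assume "\<epsilon> > 0"
      from order_tendstoD(2)[OF \<delta>(1), of "\<epsilon> / 2"] \<open>\<epsilon> > 0\<close>
      obtain K where K: "\<delta> K < \<epsilon> / 2" by (auto simp: eventually_sequentially)
      have "\<forall>\<^sub>F n in sequentially. (real K + \<delta> K) / real n < \<epsilon> / 2"
        by (rule order_tendstoD(2)[OF lim_const_over_n]) (use \<open>\<epsilon> > 0\<close> in simp)
      moreover have "\<forall>\<^sub>F n in sequentially. E K (Suc n) \<le> real (Suc n) * \<delta> K"
        using E0[of K] by (simp only: eventually_sequentially_Suc[of "\<lambda>n. E K n \<le> real n * \<delta> K"])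
      ultimately show "\<forall>\<^sub>F n in sequentially. dist (?s n / real n) 0 < \<epsilon>"
        using eventually_gt_at_top[of 0]
      proof eventually_elim
        fix n :: nat
        assume n: "(real K + \<delta> K) / real n < \<epsilon> / 2" "E K (Suc n) \<le> real (Suc n) * \<delta> K" "0 < n"
        have "0 \<le> E K n" unfolding E_def by (rule sum_nonneg) simp
        moreover have "E K (Suc n) = E K n + max (?s n - real K) 0" by (simp add: E_def)
        ultimately have "?s n \<le> (real K + \<delta> K) + real n * \<delta> K"
          using n(2) by (simp add: distrib_right)
        then have "?s n / real n \<le> ((real K + \<delta> K) + real n * \<delta> K) / real n"
          by (rule divide_right_mono) simp
        also have "\<dots> = (real K + \<delta> K) / real n + \<delta> K" using n(3) by (simp add: add_divide_distrib)
        also have "\<dots> < \<epsilon> / 2 + \<epsilon> / 2" using n(1) K by (rule add_strict_mono)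
        finally show "dist (?s n / real n) 0 < \<epsilon>" using s[of n] by simp
      qed
    qed
    show ?case
      using path_average_tendsto_0[OF _ s c(1) elim(1) I0[unfolded I_def] s0] by blast
  qed
qed

end

section \<open>Unitary evolution and conjugation\<close>


lemma cadj_mult: "cadj (A ** B) = cadj B ** cadj A" for A B :: "complex^'n^'n"
  by (simp add: cadj_def matrix_matrix_mult_def vec_eq_iff mult.commute)

lemma cadj_cadj [simp]: "cadj (cadj A) = A"
  by (simp add: cadj_def vec_eq_iff)

lemma cadj_mat_1 [simp]: "cadj (mat 1) = mat 1"
  by (simp add: cadj_def mat_def vec_eq_iff)

definition mpow :: "complex^'n^'n \<Rightarrow> nat \<Rightarrow> complex^'n^'n" where
  "mpow A k = ((\<lambda>B. A ** B) ^^ k) (mat 1)"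

lemma mpow_0 [simp]: "mpow A 0 = mat 1" and mpow_Suc: "mpow A (Suc k) = A ** mpow A k"
  by (simp_all add: mpow_def)

lemma mpow_cscale: "mpow (cscale c A) k = cscale (c ^ k) (mpow A k)"
proof (induction k)
  case 0
  show ?case by (simp add: cscale_def vec_eq_iff)
next
  case (Suc k)
  show ?case unfolding mpow_Suc Suc
    by (simp add: cscale_def vec_eq_iff matrix_matrix_mult_def sum_distrib_left mult_ac)
qed

lemma norm_mpow_entry_le: "norm (mpow A k $ i $ j) \<le> (\<Sum>i\<in>UNIV. \<Sum>j\<in>UNIV. norm (A $ i $ j)) ^ k"
proof (induction k arbitrary: i)
  case 0
  show ?case by (simp add: mat_def)
next
  case (Suc k)
  let ?B = "\<Sum>i\<in>UNIV. \<Sum>j\<in>UNIV. norm (A $ i $ j)"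
  have "norm (mpow A (Suc k) $ i $ j) \<le> (\<Sum>l\<in>UNIV. norm (A $ i $ l) * ?B ^ k)"
    unfolding mpow_Suc matrix_matrix_mult_def
    by (simp, rule sum_norm_le) (auto simp: norm_mult intro!: mult_left_mono Suc)
  also have "\<dots> = (\<Sum>l\<in>UNIV. norm (A $ i $ l)) * ?B ^ k" by (simp add: sum_distrib_right)
  also have "\<dots> \<le> ?B * ?B ^ k"
    by (intro mult_right_mono member_le_sum[of i UNIV "\<lambda>i. \<Sum>l\<in>UNIV. norm (A $ i $ l)"] zero_le_power sum_nonneg) auto
  finally show ?case by simp
qed

text \<open>An entry of exp(z A), written as a scalar power series in a complex variable so that the
  theory of termwise differentiation applies.\<close>

definition exp_entry :: "complex^'n^'n \<Rightarrow> 'n \<Rightarrow> 'n \<Rightarrow> complex \<Rightarrow> complex" where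
  "exp_entry A i j z = (\<Sum>k. mpow A k $ i $ j / fact k * z ^ k)"

lemma summable_exp_entry: "summable (\<lambda>k. mpow A k $ i $ j / fact k * z ^ k)"
proof (rule summable_comparison_test')
  let ?B = "\<Sum>i\<in>UNIV. \<Sum>j\<in>UNIV. norm (A $ i $ j)"
  show "summable (\<lambda>k. inverse (fact k) * (?B * norm z) ^ k)"
    by (rule summable_exp)
  fix k :: nat assume "0 \<le> k"
  have "norm (mpow A k $ i $ j / fact k * z ^ k) = norm (mpow A k $ i $ j) * (norm z ^ k / fact k)"
    by (simp add: norm_mult norm_divide norm_power)
  also have "\<dots> \<le> ?B ^ k * (norm z ^ k / fact k)"
    by (rule mult_right_mono[OF norm_mpow_entry_le]) simp
  also have "\<dots> = inverse (fact k) * (?B * norm z) ^ k"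
    by (simp add: power_mult_distrib divide_inverse)
  finally show "norm (mpow A k $ i $ j / fact k * z ^ k) \<le> inverse (fact k) * (?B * norm z) ^ k" .
qed

lemma mexp_cscale: "mexp (cscale c A) = (\<chi> i j. exp_entry A i j c)"
proof -
  have "(\<lambda>k. cscale (1 / of_nat (fact k)) (mpow (cscale c A) k)) sums (\<chi> i j. exp_entry A i j c)"
    unfolding sums_def
  proof (intro vec_tendstoI)
    fix i j
    have "(\<lambda>k. mpow A k $ i $ j / fact k * c ^ k) sums exp_entry A i j c"
      unfolding exp_entry_def by (rule summable_sums[OF summable_exp_entry])
    moreover have "mpow A k $ i $ j / fact k * c ^ k = cscale (1 / of_nat (fact k)) (mpow (cscale c A) k) $ i $ j" for k
      unfolding mpow_cscale by (simp add: cscale_def)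
    ultimately show "(\<lambda>n. (\<Sum>k<n. cscale (1 / of_nat (fact k)) (mpow (cscale c A) k)) $ i $ j)
        \<longlonglongrightarrow> (\<chi> i j. exp_entry A i j c) $ i $ j"
      unfolding sums_def by simp
  qed
  then show ?thesis unfolding mexp_def mpow_def by (rule sums_unique[symmetric])
qed

lemma exp_entry_0: "exp_entry A i j 0 = mat 1 $ i $ j"
  unfolding exp_entry_def by (subst powser_zero) simp

text \<open>Differentiating the series shifts its coefficients by one, and the additional factor
  \<open>A\<close> comes out on the left: (exp zA)' = A exp zA.\<close>

lemma exp_entry_has_field_derivative:
  "(exp_entry A i j has_field_derivative (\<Sum>l\<in>UNIV. A $ i $ l * exp_entry A l j z)) (at z)"
proof -
  let ?c = "\<lambda>i k. mpow A k $ i $ j / fact k"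
  have "diffs (?c i) k = (\<Sum>l\<in>UNIV. A $ i $ l * ?c l k)" for k
  proof -
    have "diffs (?c i) k = mpow A (Suc k) $ i $ j / fact k"
      by (simp add: diffs_def fact_Suc del: of_nat_Suc)
    then show ?thesis by (simp add: mpow_Suc matrix_matrix_mult_def sum_divide_distrib)
  qed
  then have "(\<Sum>k. diffs (?c i) k * z ^ k) = (\<Sum>k. \<Sum>l\<in>UNIV. A $ i $ l * (?c l k * z ^ k))"
    by (simp add: sum_distrib_right mult.assoc)
  also have "\<dots> = (\<Sum>l\<in>UNIV. \<Sum>k. A $ i $ l * (?c l k * z ^ k))"
    by (rule suminf_sum) (intro summable_mult summable_exp_entry)
  also have "\<dots> = (\<Sum>l\<in>UNIV. A $ i $ l * exp_entry A l j z)"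
    unfolding exp_entry_def by (intro sum.cong refl suminf_mult summable_exp_entry)
  finally show ?thesis
    using termdiffs_strong_converges_everywhere[of "?c i" z] summable_exp_entry[of A i j]
    unfolding exp_entry_def[abs_def] by simp
qed

lemma evol_entry: "evol H t $ i $ j = exp_entry H i j (- \<i> * of_real t)"
  by (simp add: evol_def mexp_cscale)

lemma evol_0: "evol H 0 = mat 1"
  by (simp add: vec_eq_iff evol_entry exp_entry_0)

lemma evol_entry_has_vector_derivative:
  "((\<lambda>t. evol H t $ i $ j) has_vector_derivative - \<i> * (\<Sum>l\<in>UNIV. H $ i $ l * evol H t $ l $ j)) (at t)"
proof -
  have "((\<lambda>t. - \<i> * complex_of_real t) has_vector_derivative - \<i>) (at t)"
    by (auto intro!: derivative_eq_intros simp: has_vector_derivative_def scaleR_conv_of_real)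
  from field_vector_diff_chain_at[OF this exp_entry_has_field_derivative[of H i j]]
  show ?thesis by (simp add: o_def evol_entry)
qed

lemma continuous_on_evol: "continuous_on S (evol H)"
proof -
  have "continuous_on S (\<lambda>t. \<chi> i j. evol H t $ i $ j)"
    by (intro continuous_on_vec_lambda continuous_at_imp_continuous_on ballI)
      (rule has_vector_derivative_continuous[OF evol_entry_has_vector_derivative])
  then show ?thesis by (simp add: vec_lambda_eta)
qed

text \<open>The contributions i H and - i H of the two factors cancel in the derivative of the
  product, which is therefore constant and equal to its value at time 0.\<close>

lemma evol_unitary:
  assumes "hermitian H"
  shows "cadj (evol H t) ** evol H t = mat 1"
proof -
  have H: "cnj (H $ k $ l) = H $ l $ k" for k l
    using assms by (metis complex_cnj_cnj hermitian_def)
  let ?U = "\<lambda>t. evol H t"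
  have "(\<Sum>k\<in>UNIV. cnj (?U t $ k $ i) * ?U t $ k $ j) = mat 1 $ i $ j" for i j
  proof -
    let ?g = "\<lambda>t. \<Sum>k\<in>UNIV. cnj (?U t $ k $ i) * ?U t $ k $ j"
    have "(?g has_vector_derivative 0) (at t)" for t
    proof -
      have "(?g has_vector_derivative (\<Sum>k\<in>UNIV. cnj (?U t $ k $ i) * (- \<i> * (\<Sum>l\<in>UNIV. H $ k $ l * ?U t $ l $ j))
          + cnj (- \<i> * (\<Sum>l\<in>UNIV. H $ k $ l * ?U t $ l $ i)) * ?U t $ k $ j)) (at t)"
        by (intro has_vector_derivative_sum has_vector_derivative_mult has_vector_derivative_cnj
            evol_entry_has_vector_derivative)
      also have "(\<Sum>k\<in>UNIV. cnj (?U t $ k $ i) * (- \<i> * (\<Sum>l\<in>UNIV. H $ k $ l * ?U t $ l $ j))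
          + cnj (- \<i> * (\<Sum>l\<in>UNIV. H $ k $ l * ?U t $ l $ i)) * ?U t $ k $ j)
          = \<i> * ((\<Sum>k\<in>UNIV. \<Sum>l\<in>UNIV. H $ l $ k * cnj (?U t $ l $ i) * ?U t $ k $ j)
            - (\<Sum>k\<in>UNIV. \<Sum>l\<in>UNIV. H $ k $ l * cnj (?U t $ k $ i) * ?U t $ l $ j))"
        by (simp add: H sum.distrib sum_subtractf sum_negf sum_distrib_left sum_distrib_right right_diff_distrib mult_ac)
      also have "\<dots> = 0"
        by (subst sum.swap) simp
      finally show ?thesis .
    qed
    then have "\<exists>c. \<forall>t\<in>UNIV. ?g t = c"
      by (intro has_derivative_zero_constant) (auto simp: has_vector_derivative_def)
    then obtain c where "?g t = c" for t by blast
    then have "?g t = ?g 0" by simp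
    also have "\<dots> = mat 1 $ i $ j"
      by (simp add: evol_0 mat_def if_distrib[of cnj] if_distrib[of "\<lambda>x. x * _"] cong: if_cong)
    finally show ?thesis .
  qed
  then show ?thesis by (simp add: vec_eq_iff matrix_matrix_mult_def cadj_def)
qed

section \<open>Conjugation as an isometry, and quadratic forms\<close>

definition conjugation :: "complex^'n^'n \<Rightarrow> complex^'n^'n \<Rightarrow> complex^'n^'n" where
  "conjugation U v = U ** v ** cadj U"

lemma conjugation_mult: "conjugation (U ** W) v = conjugation U (conjugation W v)"
  by (simp add: conjugation_def cadj_mult matrix_mul_assoc)

lemma conjugation_mat_1 [simp]: "conjugation (mat 1) v = v"
  by (simp add: conjugation_def)

lemma linear_conjugation: "linear (conjugation U)"
proof (rule linearI)
  show "conjugation U (v + w) = conjugation U v + conjugation U w" for v w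
    by (simp add: conjugation_def matrix_matrix_mult_def vec_eq_iff sum.distrib distrib_left distrib_right)
  show "conjugation U (r *\<^sub>R v) = r *\<^sub>R conjugation U v" for r v
    by (simp add: conjugation_def matrix_matrix_mult_def vec_eq_iff flip: scaleR_sum_right)
qed

lemma trace_conjugation:
  assumes "cadj U ** U = mat 1"
  shows "trace (conjugation U v) = trace v"
  unfolding conjugation_def
  by (subst trace_mul_sym) (simp add: matrix_mul_assoc assms)

text \<open>The inner product that the type carries as an iterated vector type is the real part of
  the Hilbert-Schmidt product; this is what makes unitary conjugation an isometry of a Euclidean
  space.\<close>

lemma inner_matrix_eq_trace: "v \<bullet> w = Re (trace (cadj v ** w))" for v w :: "complex^'n^'n"
proof -
  have "v \<bullet> w = (\<Sum>i\<in>UNIV. \<Sum>j\<in>UNIV. Re (cnj (v $ i $ j) * w $ i $ j))"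
    by (simp add: inner_vec_def inner_complex_def)
  also have "\<dots> = (\<Sum>j\<in>UNIV. \<Sum>i\<in>UNIV. Re (cnj (v $ i $ j) * w $ i $ j))"
    by (rule sum.swap)
  finally show ?thesis by (simp add: trace_def matrix_matrix_mult_def cadj_def)
qed

lemma norm_conjugation:
  assumes "cadj U ** U = mat 1"
  shows "norm (conjugation U v) = norm v"
proof -
  have "cadj (conjugation U v) ** conjugation U v = U ** cadj v ** (cadj U ** U) ** v ** cadj U"
    by (simp add: conjugation_def cadj_mult matrix_mul_assoc)
  also have "\<dots> = conjugation U (cadj v ** v)"
    by (simp add: assms conjugation_def matrix_mul_assoc)
  finally show ?thesis
    by (simp add: norm_eq_sqrt_inner inner_matrix_eq_trace trace_conjugation[OF assms])
qed

lemma continuous_on_conjugation_evol: "continuous_on S (\<lambda>t. conjugation (evol H t) v)"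
proof -
  have *: "continuous_on S (\<lambda>t. evol H t $ i $ j)" for i j
    by (intro continuous_on_component continuous_on_evol)
  show ?thesis
    unfolding conjugation_def matrix_matrix_mult_def cadj_def by (simp, intro continuous_intros *)
qed

definition quadratic :: "complex^'n^'n \<Rightarrow> complex^'n \<Rightarrow> complex" where
  "quadratic v x = (\<Sum>i\<in>UNIV. cnj (x $ i) * (v *v x) $ i)"

lemma sum_cnj_mult_adjoint:
  "(\<Sum>i\<in>UNIV. cnj ((A *v x) $ i) * y $ i) = (\<Sum>i\<in>UNIV. cnj (x $ i) * (cadj A *v y) $ i)"
  for A :: "complex^'n^'n"
proof -
  have "(\<Sum>i\<in>UNIV. cnj ((A *v x) $ i) * y $ i) = (\<Sum>i\<in>UNIV. \<Sum>j\<in>UNIV. cnj (A $ i $ j) * cnj (x $ j) * y $ i)"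
    by (simp add: matrix_vector_mult_def sum_distrib_right)
  also have "\<dots> = (\<Sum>j\<in>UNIV. \<Sum>i\<in>UNIV. cnj (A $ i $ j) * cnj (x $ j) * y $ i)"
    by (rule sum.swap)
  finally show ?thesis
    by (simp add: matrix_vector_mult_def cadj_def sum_distrib_left mult_ac)
qed

lemma quadratic_mult: "quadratic v (J *v x) = quadratic (cadj J ** v ** J) x"
  by (simp add: quadratic_def sum_cnj_mult_adjoint matrix_vector_mul_assoc matrix_mul_assoc)

lemma quadratic_axis: "quadratic v (axis i 1 + axis j w) =
  v $ i $ i + v $ i $ j * w + cnj w * v $ j $ i + cnj w * v $ j $ j * w"
  for v :: "complex^'n^'n"
proof -
  let ?x = "axis i 1 + axis j w :: complex^'n"
  have *: "(\<Sum>k\<in>UNIV. f k * ?x $ k) = f i + f j * w" for f :: "'n \<Rightarrow> complex"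
    by (simp add: axis_def distrib_left sum.distrib if_distrib[of "\<lambda>x. _ * x"] cong: if_cong)
  have **: "(\<Sum>k\<in>UNIV. cnj (?x $ k) * f k) = f i + cnj w * f j" for f :: "'n \<Rightarrow> complex"
    by (simp add: axis_def distrib_right sum.distrib if_distrib[of cnj] if_distrib[of "\<lambda>x. x * _"] cong: if_cong)
  show ?thesis unfolding quadratic_def ** matrix_vector_mult_def vec_lambda_beta * by (simp add: algebra_simps)
qed

text \<open>Complex polarisation: with the diagonal known to vanish, the weights 1 and \<i> give the
  sum and the difference of each pair of mirrored entries.\<close>

lemma eq_0_of_quadratic_eq_0:
  assumes "\<And>x. quadratic v x = 0"
  shows "v = 0"
proof -
  have d: "v $ i $ i = 0" for i
    using assms[of "axis i 1 + axis i 0"] unfolding quadratic_axis by simp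
  have "v $ i $ j = 0" for i j
  proof -
    have "v $ i $ j + v $ j $ i = 0"
      using assms[of "axis i 1 + axis j 1"] unfolding quadratic_axis by (simp add: d)
    moreover have "\<i> * (v $ i $ j - v $ j $ i) = 0"
      using assms[of "axis i 1 + axis j \<i>"] unfolding quadratic_axis by (simp add: d algebra_simps)
    ultimately show ?thesis by simp
  qed
  then show ?thesis by (simp add: vec_eq_iff)
qed

lemma quadratic_scaleR: "quadratic v (r *\<^sub>R x) = of_real (r\<^sup>2) * quadratic v x"
proof -
  have "v *v (r *\<^sub>R x) = r *\<^sub>R (v *v x)"
    by (simp add: vec_eq_iff matrix_vector_mult_def flip: scaleR_sum_right)
  then show ?thesis
    by (simp add: quadratic_def sum_distrib_left power2_eq_square scaleR_conv_of_real[where 'a=complex] mult_ac)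
qed

text \<open>Summing the constant over the standard basis gives the trace, so the constant is 0;
  homogeneity then extends this to all vectors.\<close>

lemma eq_0_of_quadratic_constant_on_sphere:
  fixes v :: "complex^'n^'n"
  assumes "\<And>x y. norm x = 1 \<Longrightarrow> norm y = 1 \<Longrightarrow> quadratic v x = quadratic v y" and "trace v = 0"
  shows "v = 0"
proof (rule eq_0_of_quadratic_eq_0)
  have q: "quadratic v (axis i 1) = v $ i $ i" for i
    using quadratic_axis[of v i i 0] by (simp add: axis_eq_0_iff[THEN iffD2])
  have one: "quadratic v x = 0" if "norm x = 1" for x
  proof -
    have "of_nat CARD('n) * quadratic v x = (\<Sum>i\<in>(UNIV::'n set). quadratic v x)" by simp
    also have "\<dots> = (\<Sum>i\<in>UNIV. v $ i $ i)"
      by (intro sum.cong refl) (simp add: q[symmetric] assms(1)[OF that])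
    finally show ?thesis using \<open>trace v = 0\<close> by (simp add: trace_def)
  qed
  show "quadratic v x = 0" for x
  proof (cases "x = 0")
    case False
    then have "quadratic v (x /\<^sub>R norm x) = 0" by (intro one) simp
    then have "quadratic v (norm x *\<^sub>R (x /\<^sub>R norm x)) = 0"
      by (simp only: quadratic_scaleR mult_zero_right)
    then show ?thesis using False by simp
  qed (simp add: quadratic_def)
qed

section \<open>Controllability and the conclusion\<close>


lemma Jprod_cong: "(\<And>j. 1 \<le> j \<Longrightarrow> j \<le> n \<Longrightarrow> s j = s' j) \<Longrightarrow> Jprod H1 H2 n s = Jprod H1 H2 n s'"
  by (induction n) simp_all

lemma Jprod_unitary:
  assumes "hermitian H1" "hermitian H2"
  shows "cadj (Jprod H1 H2 n s) ** Jprod H1 H2 n s = mat 1"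
proof (induction n)
  case (Suc n)
  let ?U = "evol (if odd (Suc n) then H1 else H2) (s (Suc n))"
  have "cadj (Jprod H1 H2 (Suc n) s) ** Jprod H1 H2 (Suc n) s
      = cadj (Jprod H1 H2 n s) ** (cadj ?U ** ?U) ** Jprod H1 H2 n s"
    by (simp only: Jprod.simps cadj_mult matrix_mul_assoc)
  also have "cadj ?U ** ?U = mat 1"
    by (rule evol_unitary) (use assms in simp)
  finally show ?case using Suc by simp
qed simp

text \<open>Any two unit vectors are related by y = J x with J a product of evolutions that leaves v
  invariant, and the form of v at J x is the form of J^* v J = v at x.\<close>

lemma eq_0_of_conjugation_invariant:
  assumes herm: "hermitian H1" "hermitian H2" and ctrl: "pure_state_controllable H1 H2"
    and inv: "\<And>s t. 0 \<le> s \<Longrightarrow> 0 \<le> t \<Longrightarrow> conjugation (evol H2 t) (conjugation (evol H1 s) v) = v"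
    and "trace v = 0"
  shows "v = 0"
proof (rule eq_0_of_quadratic_constant_on_sphere[OF _ \<open>trace v = 0\<close>])
  fix x y :: "complex^'a" assume xy: "norm x = 1" "norm y = 1"
  \<comment> \<open>Evolution over time 0 is the identity, so setting one of the two times to 0
    isolates the other Hamiltonian.\<close>
  have inv': "conjugation (evol (if b then H1 else H2) t) v = v" if "0 \<le> t" for b t
    using inv[of t 0] inv[of 0 t] that by (cases b) (simp_all add: evol_0)
  have J: "conjugation (Jprod H1 H2 n s) v = v" if "\<forall>j\<in>{1..n}. 0 \<le> s j" for n s
    using that by (induction n) (simp_all add: conjugation_mult inv'[of _ "odd (Suc _)", simplified])
  obtain n where n: "{Jprod H1 H2 n s *v x | s. \<forall>j\<in>{1..n}. s j \<ge> 0} = {x. norm x = 1}"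
    using ctrl xy(1) unfolding pure_state_controllable_def by blast
  then obtain s where s: "y = Jprod H1 H2 n s *v x" "\<forall>j\<in>{1..n}. s j \<ge> 0"
    using xy(2) by blast
  let ?J = "Jprod H1 H2 n s"
  have U: "cadj ?J ** ?J = mat 1" by (rule Jprod_unitary[OF herm])
  have "cadj ?J ** v ** ?J = cadj ?J ** (?J ** v ** cadj ?J) ** ?J"
    using J[OF s(2)] by (simp add: conjugation_def)
  also have "\<dots> = (cadj ?J ** ?J) ** v ** (cadj ?J ** ?J)" by (simp add: matrix_mul_assoc)
  also have "\<dots> = v" by (simp add: U)
  finally show "quadratic v x = quadratic v y" by (simp add: s(1) quadratic_mult)
qed

text \<open>If \<open>t\<close> were outside \<open>A\<close>, some interval (t, t + e) would miss
  \<open>A\<close>, although it has positive Lebesgue measure and the density is positive on it.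
  Taking the right-hand half of the ball covers t = 0 as well.\<close>

lemma closed_support_of_positive_density:
  assumes f: "distributed M lborel X f" and f_pos: "\<And>x. 0 \<le> x \<Longrightarrow> 0 < f x"
    and "closed A" and A: "AE \<omega> in M. X \<omega> \<in> A" and "prob_space M" and "0 \<le> t"
  shows "t \<in> (A :: real set)"
proof (rule ccontr)
  interpret prob_space M by fact
  assume "t \<notin> A"
  then obtain e where e: "e > 0" "ball t e \<subseteq> - A"
    using \<open>closed A\<close> by (metis ComplI closed_def open_contains_ball)
  have [measurable]: "A \<in> sets borel" using \<open>closed A\<close> by (rule borel_closed)
  have "AE x in lborel. 0 < f x \<longrightarrow> x \<in> A"
    using A by (subst (asm) distributed_AE2[OF f]) auto
  then have "AE x in lborel. x \<notin> {t<..<t + e}"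
  proof eventually_elim
    case (elim x)
    show ?case
    proof
      assume "x \<in> {t<..<t + e}"
      then have "x \<in> ball t e" "0 \<le> x" using \<open>0 \<le> t\<close> by (auto simp: dist_real_def)
      then show False using elim e f_pos by blast
    qed
  qed
  then have "emeasure lborel {t<..<t + e} = 0"
    by (subst (asm) AE_iff_measurable[of "{t<..<t + e}"]) auto
  then show False using e(1) by simp
qed

lemma (in prob_space) indep_vars_Suc:
  assumes "indep_vars (\<lambda>_. borel) X {1..}"
  shows "indep_vars (\<lambda>_. borel) (\<lambda>i. X (Suc i)) UNIV"
proof -
  have "indep_vars (\<lambda>j. PiM {Suc j} (\<lambda>_. borel)) (\<lambda>j \<omega>. restrict (\<lambda>i. X i \<omega>) {Suc j}) UNIV"
    by (rule indep_vars_restrict[OF assms]) (auto simp: disjoint_family_on_def)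
  then have "indep_vars (\<lambda>_. borel) (\<lambda>j \<omega>. (\<lambda>s. s (Suc j)) (restrict (\<lambda>i. X i \<omega>) {Suc j})) UNIV"
    by (rule indep_vars_compose2) measurable
  then show ?thesis by simp
qed

theorem mainTheorem15:
  fixes H1 H2 :: "complex^'n^'n" and M :: "'w measure" and \<tau> :: "nat \<Rightarrow> 'w \<Rightarrow> real"
  assumes "hermitian H1" and "hermitian H2"
    and "condition_D M \<tau>"
    and "pure_state_controllable H1 H2"
    and "density_matrix \<rho>0"
  shows "AE \<omega> in M. cesaro_conv
           (\<lambda>t. Xproc H1 H2 \<tau> t \<omega> ** \<rho>0 ** cadj (Xproc H1 H2 \<tau> t \<omega>))
           (cscale (1 / of_nat CARD('n)) (mat 1))"
proof -
  let ?C = "cscale (1 / of_nat CARD('n)) (mat 1) :: complex^'n^'n"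
  define H where "H = (\<lambda>b. if b then H1 else H2)"
  have herm: "hermitian (H b)" for b using assms(1,2) by (simp add: H_def)
  define R where "R = (\<lambda>b t. conjugation (evol (H b) t))"
  define x0 where "x0 = \<rho>0 - ?C"
  \<comment> \<open>Condition D numbers the times from 1 and the locale from 0.\<close>
  define \<sigma> where "\<sigma> = (\<lambda>i. \<tau> (Suc i))"
  note D = assms(3)[unfolded condition_D_def]
  interpret prob_space M using D by blast
  obtain f where f: "distributed M lborel (\<tau> 1) f" "\<And>x. 0 \<le> x \<Longrightarrow> 0 < f x" using D by blast
  have linear_trace: "linear (trace :: complex^'n^'n \<Rightarrow> complex)"
    by (rule linearI) (simp_all add: trace_def sum.distrib scaleR_sum_right)
  have trace_C: "trace ?C = 1" by (simp add: trace_def cscale_def mat_def)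
  interpret mixing_switching M \<sigma> R x0 trace
  proof (intro mixing_switching.intro random_switching.intro random_switching_axioms.intro
      mixing_switching_axioms.intro)
    show "prob_space M" by (rule prob_space_axioms)
    show "indep_vars (\<lambda>_. borel) \<sigma> UNIV"
      unfolding \<sigma>_def using D by (intro indep_vars_Suc) blast
    show "distr M borel (\<sigma> i) = distr M borel (\<sigma> 0)" for i
      using D unfolding \<sigma>_def by (metis One_nat_def le_add1 plus_1_eq_Suc)
    show "linear (R b t)" for b t unfolding R_def by (rule linear_conjugation)
    show "norm (R b t v) = norm v" for b t v
      unfolding R_def by (intro norm_conjugation evol_unitary herm)
    show "continuous_on UNIV (\<lambda>t. R b t v)" for b v
      unfolding R_def by (rule continuous_on_conjugation_evol)
    show "t \<in> A" if "closed A" "AE \<omega> in M. \<sigma> 0 \<omega> \<in> A" "0 \<le> t" for A t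
      using closed_support_of_positive_density[OF f that(1) _ prob_space_axioms that(3)] that(2)
      by (simp add: \<sigma>_def)
    show "AE \<omega> in M. 0 < \<sigma> 0 \<omega>" "integrable M (\<sigma> 0)" using D by (simp_all add: \<sigma>_def)
    show "linear (trace :: complex^'n^'n \<Rightarrow> complex)" by (rule linear_trace)
    show "trace (R b t v) = trace v" for b t v
      unfolding R_def by (intro trace_conjugation evol_unitary herm)
    show "trace x0 = 0"
      using assms(5) by (simp add: x0_def linear_diff[OF linear_trace] trace_C density_matrix_def)
    show "v = 0" if "\<And>s t. 0 \<le> s \<Longrightarrow> 0 \<le> t \<Longrightarrow> R False t (R True s v) = v" "trace v = 0" for v
      using eq_0_of_conjugation_invariant[OF assms(1,2,4) _ that(2)] that(1) by (simp add: R_def H_def)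
  qed
  have ts: "tsum \<tau> n \<omega> = (\<Sum>i<n. \<sigma> i \<omega>)" for n \<omega>
    by (simp add: tsum_def \<sigma>_def sum.atLeast1_atMost_eq)
  have st: "state n (\<lambda>i. \<sigma> i \<omega>) = conjugation (Jprod H1 H2 n (\<lambda>j. \<tau> j \<omega>)) x0" for n \<omega>
  proof (induction n)
    case (Suc n)
    then show ?case unfolding state.simps by (simp add: R_def H_def \<sigma>_def conjugation_mult)
  qed simp
  show ?thesis using path_average AE_pos
  proof eventually_elim
    case (elim \<omega>)
    let ?X = "\<lambda>t. Xproc H1 H2 \<tau> t \<omega>"
    define \<xi> where "\<xi> = (\<lambda>t. conjugation (?X t) x0)"
    have "is_path (\<lambda>i. \<sigma> i \<omega>) \<xi>"
      unfolding is_path_def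
    proof (intro allI impI)
      fix n u assume u: "(\<Sum>i<n. \<sigma> i \<omega>) \<le> u" "u < (\<Sum>i<Suc n. \<sigma> i \<omega>)"
      \<comment> \<open>Between t_n and t_(n+1) the least index is n + 1: n complete times lie
        behind, and the last factor of the product runs for the elapsed time u - t_n.\<close>
      have "(LEAST m. u < tsum \<tau> m \<omega>) = Suc n"
      proof (rule Least_equality)
        show "u < tsum \<tau> (Suc n) \<omega>" using u(2) by (simp add: ts)
        fix m assume m: "u < tsum \<tau> m \<omega>"
        show "Suc n \<le> m"
        proof (rule ccontr)
          assume "\<not> Suc n \<le> m"
          then have "tsum \<tau> m \<omega> \<le> tsum \<tau> n \<omega>"
            unfolding ts using elim(2) by (intro sum_mono2) (auto intro: less_imp_le)
          then show False using m u(1) by (simp add: ts)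
        qed
      qed
      then have "?X u = Jprod H1 H2 (Suc n) (\<lambda>j. if j < Suc n then \<tau> j \<omega> else u - tsum \<tau> (Suc n - 1) \<omega>)"
        by (simp only: Xproc_def Let_def)
      also have "\<dots> = evol (H (even n)) (u - (\<Sum>i<n. \<sigma> i \<omega>)) ** Jprod H1 H2 n (\<lambda>j. \<tau> j \<omega>)"
        using Jprod_cong[of n "\<lambda>j. if j < Suc n then \<tau> j \<omega> else u - tsum \<tau> (Suc n - 1) \<omega>" "\<lambda>j. \<tau> j \<omega>" H1 H2]
        by (simp add: H_def ts)
      finally show "\<xi> u = R (even n) (u - (\<Sum>i<n. \<sigma> i \<omega>)) (state n (\<lambda>i. \<sigma> i \<omega>))"
        unfolding st by (simp add: \<xi>_def R_def conjugation_mult)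
    qed
    with elim(1) have lim: "((\<lambda>T. integral {0..T} \<xi> /\<^sub>R T) \<longlongrightarrow> 0) at_top"
      and int: "\<And>T. 0 \<le> T \<Longrightarrow> \<xi> integrable_on {0..T}" by blast+
    have U: "cadj (?X t) ** ?X t = mat 1" for t
      unfolding Xproc_def Let_def by (rule Jprod_unitary[OF assms(1,2)])
    have "conjugation (?X t) ?C = ?C" for t
    proof -
      have "conjugation (?X t) ?C = cscale (1 / of_nat CARD('n)) (?X t ** cadj (?X t))"
        by (simp add: conjugation_def cscale_def matrix_matrix_mult_def vec_eq_iff mat_def sum_distrib_left
            mult_ac if_distrib[of "\<lambda>x. x * _"] if_distrib[of "\<lambda>x. _ * x"] cong: if_cong)
      also have "?X t ** cadj (?X t) = mat 1" by (rule matrix_left_right_inverse1[OF U])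
      finally show ?thesis .
    qed
    then have \<rho>: "?X t ** \<rho>0 ** cadj (?X t) = \<xi> t + ?C" for t
      using linear_add[OF linear_conjugation, of "?X t" x0 ?C]
      by (simp add: \<xi>_def x0_def conjugation_def)
    show ?case
      unfolding cesaro_conv_def \<rho>
    proof (intro allI impI)
      fix A :: "complex^'n^'n"
      \<comment> \<open>The null set was fixed before \<open>A\<close>. Each observable is a bounded
        real-linear functional and passes through the matrix-valued integral and its limit.\<close>
      define h where "h = (\<lambda>v. trace (v ** A))"
      have "linear h"
        unfolding h_def
        by (rule linearI)
          (simp_all add: trace_def matrix_matrix_mult_def distrib_right sum.distrib scaleR_sum_right)
      then have h: "bounded_linear h" by (rule linear_conv_bounded_linear[THEN iffD1])
      have "complex_of_real (1 / T) * integral {0..T} (\<lambda>t. h (\<xi> t + ?C)) = h (integral {0..T} \<xi> /\<^sub>R T) + h ?C"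
        if "0 < T" for T
      proof -
        have "((\<lambda>t. \<xi> t + ?C) has_integral integral {0..T} \<xi> + T *\<^sub>R ?C) {0..T}"
          using has_integral_add[OF integrable_integral[OF int] has_integral_const_real[of ?C 0 T]] that by simp
        from has_integral_linear[OF this h]
        have "integral {0..T} (\<lambda>t. h (\<xi> t + ?C)) = h (integral {0..T} \<xi> + T *\<^sub>R ?C)"
          by (simp add: o_def integral_unique)
        also have "\<dots> = h (integral {0..T} \<xi>) + T *\<^sub>R h ?C"
          by (simp add: linear_add[OF \<open>linear h\<close>] linear_cmul[OF \<open>linear h\<close>])
        finally show ?thesis
          using that by (simp add: linear_cmul[OF \<open>linear h\<close>] scaleR_conv_of_real[where 'a=complex] field_simps)
      qed
      then have "\<forall>\<^sub>F T in at_top. h (integral {0..T} \<xi> /\<^sub>R T) + h ?C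
          = complex_of_real (1 / T) * integral {0..T} (\<lambda>t. h (\<xi> t + ?C))"
        by (intro eventually_mono[OF eventually_gt_at_top[of 0]]) simp
      moreover have "((\<lambda>T. h (integral {0..T} \<xi> /\<^sub>R T) + h ?C) \<longlongrightarrow> h ?C) at_top"
        using tendsto_add[OF bounded_linear.tendsto[OF h lim] tendsto_const[of "h ?C"]]
        by (simp add: linear_0[OF \<open>linear h\<close>])
      ultimately show "((\<lambda>T. complex_of_real (1 / T) * integral {0..T} (\<lambda>t. trace ((\<xi> t + ?C) ** A)))
          \<longlongrightarrow> trace (?C ** A)) at_top"
        unfolding h_def by (rule Lim_transform_eventually[rotated])
    qed
  qed
qed

end
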